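(* Let $Y$ be a random simplicial complex on $[n]=\{0,\dots,n\}$ drawn from the lower model with a homogeneous system of probability parameters in the medial regime, with constants $0<p\le P<1$ such that $p\le p_\sigma\le P$ for all $\sigma$. Then for any constant $\delta_0>0$, asymptotically almost surely, $H_j(Y;\mathbb Q)=0$ for all $0<j\le\log_2\log_{(p^{-1})}n-1-\delta_0$.
   Context: Lower model: each non-empty proper subset $\sigma\subsetneq[n]$ is included independently with probability $p_\sigma$ into a random hypergraph $X$, and $Y$ is the largest simplicial complex contained in $X$ ($\sigma\in Y$ iff every non-empty $\tau\subseteq\sigma$ lies in $X$). Medial regime: $p,P\in(0,1)$ are independent of $n$. Homogeneous: $p_\sigma=p_{\sigma'}$ whenever $\dim\sigma=\dim\sigma'$ (where $\dim\sigma=|\sigma|-1$). Asymptotically almost surely means with probability tending to $1$ as $n\to\infty$. *)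

theory Defs
  imports "HOL-Probability.Probability"
begin

definition lm_index :: "nat \<Rightarrow> nat set set" where
  "lm_index n = {\<sigma>. \<sigma> \<noteq> {} \<and> \<sigma> \<subset> {0..n}}"

text \<open>Random hypergraph X of the lower model on [n]: each \<sigma> is included independently
with probability q n (dim \<sigma>) (homogeneous system; dim \<sigma> = card \<sigma> - 1).\<close>
definition lower_hypergraph :: "(nat \<Rightarrow> nat \<Rightarrow> real) \<Rightarrow> nat \<Rightarrow> (nat set \<Rightarrow> bool) pmf" where
  "lower_hypergraph q n =
     Pi_pmf (lm_index n) False (\<lambda>\<sigma>. bernoulli_pmf (q n (card \<sigma> - 1)))"

text \<open>Largest simplicial complex contained in X.\<close>
definition lower_complex :: "(nat set \<Rightarrow> bool) \<Rightarrow> nat set set" where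
  "lower_complex X = {\<sigma>. \<sigma> \<noteq> {} \<and> (\<forall>\<tau>. \<tau> \<noteq> {} \<and> \<tau> \<subseteq> \<sigma> \<longrightarrow> X \<tau>)}"

definition faces :: "nat set set \<Rightarrow> nat \<Rightarrow> nat set set" where
  "faces K j = {\<sigma> \<in> K. card \<sigma> = j + 1}"

definition chain :: "nat set set \<Rightarrow> nat \<Rightarrow> (nat set \<Rightarrow> rat) \<Rightarrow> bool" where
  "chain K j c \<longleftrightarrow> (\<forall>\<sigma>. \<sigma> \<notin> faces K j \<longrightarrow> c \<sigma> = 0)"

text \<open>Boundary map \<partial>_j (for j \<ge> 1): removing the i-th vertex (in increasing order)
of a j-simplex contributes sign (-1)^i.\<close>
definition bd :: "nat set set \<Rightarrow> nat \<Rightarrow> (nat set \<Rightarrow> rat) \<Rightarrow> nat set \<Rightarrow> rat" where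
  "bd K j c \<tau> =
     (if \<tau> \<in> faces K (j - 1)
      then (\<Sum>v \<in> \<Union>K - \<tau>. (-1) ^ card {u \<in> \<tau>. u < v} * c (insert v \<tau>))
      else 0)"

definition homology_vanishes :: "nat set set \<Rightarrow> nat \<Rightarrow> bool" where
  "homology_vanishes K j \<longleftrightarrow>
     (\<forall>c. chain K j c \<and> bd K j c = (\<lambda>_. 0) \<longrightarrow>
        (\<exists>d. chain K (j + 1) d \<and> bd K (j + 1) d = c))"

end

theory Submission
  imports Defs "HOL-Real_Asymp.Real_Asymp"
begin

text \<open>
Garland's method. Over \<open>\<rat>\<close> every \<open>j\<close>-cycle can be moved, by subtracting a boundary, to be orthogonal to
all boundaries for the form weighted by \<open>1 / w\<close>, where \<open>w \<sigma>\<close> is the number of cofaces of \<open>\<sigma>\<close>; dividing by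
\<open>w\<close> gives a cochain that is closed and coclosed. Restricting it to the links of the \<open>(j - 1)\<close>-faces shows
that it vanishes as soon as all their link graphs have normalised spectral gap above \<open>j / (j + 1)\<close>.

The link graph of \<open>\<tau>\<close> is a binomial random graph on a random vertex set; homogeneity makes all its edges
equally likely. With \<open>j \<le> log\<^sub>2 log\<^bsub>1/p\<^esub> n - 1 - \<delta>\<close> its expected degree is at least \<open>n\<^bsup>\<epsilon>\<^esup> / 2\<close>. The trace of
the \<open>2k\<close>-th power of its centred adjacency matrix with \<open>k\<close> about \<open>ln n\<close>, together with Chernoff bounds for the
degrees, yields the gap with a failure probability small enough for a union bound over all \<open>\<tau>\<close>.
\<close>

section \<open>Garland's method\<close>

text \<open>The admissible degrees grow with \<open>n\<close>, so the number of sets \<tau> may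
  reach about n^(log log n), more than any polynomial. A trace power of fixed order would make the
  failure probability only polynomially small; with \<open>k\<close> about \<open>ln n\<close> it is
  roughly exp(-\<epsilon> (ln n)^2), which wins. Walks can then be counted crudely: the loss is
  polylogarithmic per power of a degree that is itself a power of \<open>n\<close>.

  A set \<tau> of m vertices has 2^m subsets, so a vertex of its link requires 2^m hyperedges beyond
  the subsets of \<tau>, and an edge 2^m more. The expected degree is thus at least of order n
  p^(2^(m+1)). The exponent m + 1 explains the -1 in the range of degrees, and \<delta> leaves
  \<epsilon> = 1 - 2^(-\<delta>). None of these hyperedges is a subset of \<tau>, so the link graph
  makes sense, with the same law, for every vertex set \<tau>, without conditioning on \<tau> being
  a face.

  The weight reconciles two notions: a cycle is coclosed for the plain pairing, Garland's identity
  wants coclosedness for the pairing weighted by \<open>w\<close>, and dividing by \<open>w\<close>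
  passes from one to the other.\<close>

definition ext :: "nat set set \<Rightarrow> nat set \<Rightarrow> nat set" where
  "ext K \<sigma> = {v \<in> \<Union>K - \<sigma>. insert v \<sigma> \<in> K}"

definition vsign :: "nat set \<Rightarrow> nat \<Rightarrow> rat" where
  "vsign \<tau> v = (-1) ^ card {u \<in> \<tau>. u < v}"

lemma vsign_square [simp]: "vsign \<tau> v * vsign \<tau> v = 1"
  unfolding vsign_def by (simp flip: power_mult_distrib)

lemma vsign_insert_less:
  assumes "finite \<tau>" "u \<notin> \<tau>" "u < v"
  shows "vsign (insert u \<tau>) v = - vsign \<tau> v"
proof -
  have "{w \<in> insert u \<tau>. w < v} = insert u {w \<in> \<tau>. w < v}" using assms by auto
  then show ?thesis using assms by (simp add: vsign_def)
qed

lemma vsign_insert_greater: "v < u \<Longrightarrow> vsign (insert u \<tau>) v = vsign \<tau> v"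
  unfolding vsign_def by (rule arg_cong[where f = "\<lambda>A. (-1) ^ card A"]) auto

text \<open>Adding a vertex flips the sign of the larger ones only, so exactly one of the two
  factors changes. This form serves the mixed terms in \<open>garland\<close>;
  \<open>vsign_swap\<close> is the same fact arranged for \<open>bd_bd\<close>.\<close>

lemma vsign_swap_insert:
  assumes "finite \<tau>" "u \<notin> \<tau>" "v \<notin> \<tau>" "u \<noteq> v"
  shows "vsign (insert v \<tau>) u * vsign (insert u \<tau>) v = - (vsign \<tau> u * vsign \<tau> v)"
  using assms by (cases "u < v")
    (auto simp: vsign_insert_less vsign_insert_greater not_less le_less)

lemma vsign_swap:
  assumes "finite \<tau>" "u \<notin> \<tau>" "v \<notin> \<tau>" "u \<noteq> v"
  shows "vsign \<tau> v * vsign (insert v \<tau>) u = - (vsign \<tau> u * vsign (insert u \<tau>) v)"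
  using assms by (cases "u < v")
    (auto simp: vsign_insert_less vsign_insert_greater not_less le_less)

text \<open>Gram-Schmidt without normalisation, so that no square root leaves the rationals. The
  residual of \<open>g y\<close> against the older \<open>g i\<close> is orthogonal to them, and one
  more projection along it handles \<open>y\<close>.\<close>

lemma exists_orthogonal_residual:
  fixes W :: "'a \<Rightarrow> rat" and g :: "'i \<Rightarrow> 'a \<Rightarrow> rat"
  assumes "finite F" "\<And>x. x \<in> F \<Longrightarrow> W x > 0" "finite I"
  shows "\<exists>d. \<forall>k\<in>I. (\<Sum>x\<in>F. W x * (c x - (\<Sum>i\<in>I. d i * g i x)) * g k x) = 0"
  using assms(3)
proof (induction I arbitrary: c rule: finite_induct)
  case empty
  then show ?case by simp
next
  case (insert y I)
  define B where "B a b = (\<Sum>x\<in>F. W x * a x * b x)" for a b :: "'a \<Rightarrow> rat"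
  obtain d where d: "\<forall>k\<in>I. B (\<lambda>x. c x - (\<Sum>i\<in>I. d i * g i x)) (g k) = 0"
    unfolding B_def using insert.IH[of c] by blast
  obtain e where e: "\<forall>k\<in>I. B (\<lambda>x. g y x - (\<Sum>i\<in>I. e i * g i x)) (g k) = 0"
    unfolding B_def using insert.IH[of "g y"] by blast
  define r where "r = (\<lambda>x. g y x - (\<Sum>i\<in>I. e i * g i x))"
  define c1 where "c1 = (\<lambda>x. c x - (\<Sum>i\<in>I. d i * g i x))"
  have lin: "B (\<lambda>x. a x - t * b x) h = B a h - t * B b h" for a b h t
    unfolding B_def by (simp add: algebra_simps sum_subtractf sum_distrib_left)
  have linr: "B h (\<lambda>x. \<Sum>i\<in>I. t i * b i x) = (\<Sum>i\<in>I. t i * B h (b i))" for b h t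
    unfolding B_def by (simp add: sum_distrib_left sum_distrib_right algebra_simps)
      (rule sum.swap)
  have linr2: "B h (\<lambda>x. a x + b x) = B h a + B h b" for a b h
    unfolding B_def by (simp add: algebra_simps sum.distrib)
  have gy: "g y = (\<lambda>x. r x + (\<Sum>i\<in>I. e i * g i x))"
    by (simp add: r_def)
  \<comment> \<open>If \<open>B r r = 0\<close> the quotient is 0. That is the right value, because
    positivity of \<open>W\<close> then makes \<open>r\<close> vanish on \<open>F\<close>; the
    \<open>g i\<close> may therefore be linearly dependent.\<close>
  define s where "s = B c1 r / B r r"
  define d' where "d' = (\<lambda>i. if i = y then s else d i - s * e i)"
  have res: "(\<lambda>x. c x - (\<Sum>i\<in>insert y I. d' i * g i x)) = (\<lambda>x. c1 x - s * r x)"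
  proof
    fix x
    have "(\<Sum>i\<in>I. d' i * g i x) = (\<Sum>i\<in>I. d i * g i x - s * (e i * g i x))"
      using insert.hyps by (intro sum.cong) (auto simp: d'_def algebra_simps)
    then show "c x - (\<Sum>i\<in>insert y I. d' i * g i x) = c1 x - s * r x"
      using insert.hyps
      by (simp add: c1_def r_def d'_def sum_subtractf sum_distrib_left algebra_simps)
  qed
  have B1: "B c1 (g k) = 0" "B r (g k) = 0" if "k \<in> I" for k
    using d e that by (auto simp: c1_def r_def)
  have "s * B r r = B c1 r"
  proof (cases "B r r = 0")
    case True
    have "\<forall>x\<in>F. W x * r x * r x = 0"
      using True unfolding B_def
      by (subst (asm) sum_nonneg_eq_0_iff) (auto simp: assms mult.assoc less_imp_le)
    then have "\<forall>x\<in>F. r x = 0" using assms(2) by fastforce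
    then have "B c1 r = 0" unfolding B_def by simp
    with True show ?thesis by simp
  qed (simp add: s_def)
  then have "B (\<lambda>x. c1 x - s * r x) r = 0" by (simp add: lin)
  moreover have old: "B (\<lambda>x. c1 x - s * r x) (g k) = 0" if "k \<in> I" for k
    using B1[OF that] by (simp add: lin)
  ultimately have "B (\<lambda>x. c1 x - s * r x) (g y) = 0"
    by (subst gy) (simp add: linr2 linr)
  with old show ?case unfolding res[symmetric] B_def by blast
qed

section \<open>Incidence sums, boundary and coboundary in a finite complex\<close>

locale finite_complex =
  fixes K :: "nat set set"
  assumes finite_K: "finite K"
    and finite_face: "\<And>\<sigma>. \<sigma> \<in> K \<Longrightarrow> finite \<sigma>"
    and nonempty_face: "\<And>\<sigma>. \<sigma> \<in> K \<Longrightarrow> \<sigma> \<noteq> {}"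
    and face_subset: "\<And>\<sigma> \<tau>. \<sigma> \<in> K \<Longrightarrow> \<tau> \<subseteq> \<sigma> \<Longrightarrow> \<tau> \<noteq> {} \<Longrightarrow> \<tau> \<in> K"
begin

lemma finite_faces [simp]: "finite (faces K j)"
  using finite_K by (simp add: faces_def)

lemma finite_ext [simp]: "finite (ext K \<sigma>)"
  using finite_K finite_face by (simp add: ext_def)

lemma finite_faceD: "\<sigma> \<in> faces K j \<Longrightarrow> finite \<sigma>"
  using finite_face by (simp add: faces_def)

lemma insert_ext_faces: "\<sigma> \<in> faces K j \<Longrightarrow> v \<in> ext K \<sigma> \<Longrightarrow> insert v \<sigma> \<in> faces K (Suc j)"
  by (auto simp: faces_def ext_def finite_face)

text \<open>Double counting of incident pairs: a face with an added vertex is the same datum as a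
  coface with a marked vertex. Every exchange of dimensions below is an instance.\<close>

lemma flag_sum:
  fixes h :: "nat set \<Rightarrow> nat \<Rightarrow> 'b::comm_monoid_add"
  shows "(\<Sum>\<sigma>\<in>faces K j. \<Sum>v\<in>ext K \<sigma>. h \<sigma> v) = (\<Sum>\<eta>\<in>faces K (Suc j). \<Sum>v\<in>\<eta>. h (\<eta> - {v}) v)"
proof -
  have "(\<Sum>(\<sigma>, v)\<in>Sigma (faces K j) (ext K). h \<sigma> v)
      = (\<Sum>(\<eta>, v)\<in>Sigma (faces K (Suc j)) (\<lambda>\<eta>. \<eta>). h (\<eta> - {v}) v)"
  proof (rule sum.reindex_bij_witness[where i = "\<lambda>(\<eta>, v). (\<eta> - {v}, v)"
        and j = "\<lambda>(\<sigma>, v). (insert v \<sigma>, v)"], goal_cases)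
    case (4 b)
    then obtain \<eta> v where b: "b = (\<eta>, v)" "\<eta> \<in> K" "card \<eta> = Suc (Suc j)" "v \<in> \<eta>"
      by (auto simp: faces_def)
    have fin: "finite \<eta>" using b finite_face by blast
    have "card (\<eta> - {v}) = Suc j" using b fin by simp
    moreover have "\<eta> - {v} \<in> K"
    proof (rule face_subset[OF b(2)])
      show "\<eta> - {v} \<noteq> {}" using \<open>card (\<eta> - {v}) = Suc j\<close> by (metis card.empty nat.distinct(1))
    qed auto
    ultimately show ?case using b by (auto simp: faces_def ext_def insert_absorb)
  qed (auto simp: insert_ext_faces ext_def insert_absorb)
  then show ?thesis by (simp add: sum.Sigma finite_faceD)
qed

lemma bd_eq:
  assumes "chain K (Suc j) c" "\<tau> \<in> faces K j"
  shows "bd K (Suc j) c \<tau> = (\<Sum>v\<in>ext K \<tau>. vsign \<tau> v * c (insert v \<tau>))"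
proof -
  have "(\<Sum>v \<in> \<Union>K - \<tau>. vsign \<tau> v * c (insert v \<tau>)) = (\<Sum>v\<in>ext K \<tau>. vsign \<tau> v * c (insert v \<tau>))"
  proof (rule sum.mono_neutral_right)
    show "finite (\<Union>K - \<tau>)" using finite_K finite_face by auto
    show "\<forall>v\<in>\<Union> K - \<tau> - ext K \<tau>. vsign \<tau> v * c (insert v \<tau>) = 0"
      using assms(1) by (auto simp: ext_def chain_def faces_def)
  qed (auto simp: ext_def)
  then show ?thesis using assms(2) by (simp add: bd_def vsign_def)
qed

lemma chain_bd: "chain K j (bd K (Suc j) d)"
  by (auto simp: chain_def bd_def)

lemma ext_insert_ext:
  assumes "\<tau> \<noteq> {}"
  shows "u \<in> ext K \<tau> \<and> v \<in> ext K (insert u \<tau>) \<longleftrightarrow>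
         u \<noteq> v \<and> u \<notin> \<tau> \<and> v \<notin> \<tau> \<and> insert u (insert v \<tau>) \<in> K"
proof -
  have "insert u \<tau> \<in> K" if "insert u (insert v \<tau>) \<in> K"
    by (rule face_subset[OF that]) auto
  moreover have "x \<in> \<Union>K" if "insert u (insert v \<tau>) \<in> K" "x = u \<or> x = v" for x
    using that by blast
  moreover have "insert v (insert u \<tau>) = insert u (insert v \<tau>)" by blast
  ultimately show ?thesis unfolding ext_def by simp blast
qed

text \<open>Swapping the two added vertices is an involution of the index set \<open>P\<close> that
  negates each term, so the sum equals its own negative.\<close>

lemma bd_bd:
  assumes "chain K (Suc (Suc j)) d"
  shows "bd K (Suc j) (bd K (Suc (Suc j)) d) = (\<lambda>_. 0)"
proof
  fix \<tau>
  show "bd K (Suc j) (bd K (Suc (Suc j)) d) \<tau> = 0"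
  proof (cases "\<tau> \<in> faces K j")
    case False
    then show ?thesis by (simp add: bd_def)
  next
    case True
    then have ne: "\<tau> \<noteq> {}" and fin: "finite \<tau>"
      using nonempty_face finite_face by (auto simp: faces_def)
    define P where "P = Sigma (ext K \<tau>) (\<lambda>v. ext K (insert v \<tau>))"
    define h where "h = (\<lambda>(v, u). vsign \<tau> v * (vsign (insert v \<tau>) u * d (insert u (insert v \<tau>))))"
    have P: "(v, u) \<in> P \<longleftrightarrow> v \<noteq> u \<and> v \<notin> \<tau> \<and> u \<notin> \<tau> \<and> insert v (insert u \<tau>) \<in> K" for u v
      using ext_insert_ext[OF ne, of v u] by (auto simp: P_def)
    have "bd K (Suc j) (bd K (Suc (Suc j)) d) \<tau> =
          (\<Sum>v\<in>ext K \<tau>. vsign \<tau> v * bd K (Suc (Suc j)) d (insert v \<tau>))"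
      by (rule bd_eq[OF chain_bd True])
    also have "\<dots> = (\<Sum>v\<in>ext K \<tau>. \<Sum>u\<in>ext K (insert v \<tau>). h (v, u))"
      using True by (intro sum.cong) (auto simp: bd_eq[OF assms insert_ext_faces] h_def sum_distrib_left)
    also have "\<dots> = sum h P" by (simp add: sum.Sigma P_def)
    finally have eq: "bd K (Suc j) (bd K (Suc (Suc j)) d) \<tau> = sum h P" .
    have "sum h P = (\<Sum>x\<in>P. - h x)"
    proof (rule sum.reindex_bij_witness[where i = prod.swap and j = prod.swap])
      fix x assume "x \<in> P"
      then obtain u v where x: "x = (v, u)" "v \<noteq> u" "v \<notin> \<tau>" "u \<notin> \<tau>"
        using P by (cases x) auto
      have "vsign \<tau> v * vsign (insert v \<tau>) u = - (vsign \<tau> u * vsign (insert u \<tau>) v)"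
        by (rule vsign_swap) (use x fin in auto)
      then show "- h (prod.swap x) = h x"
        by (simp add: x h_def insert_commute flip: mult.assoc)
    qed (auto simp: P insert_commute)
    then have "sum h P = 0" by (simp add: sum_negf)
    with eq show ?thesis by simp
  qed
qed

text \<open>The coboundary, adjoint to \<open>bd\<close> for the unweighted pairing; see
  \<open>sum_mult_bd\<close>.\<close>

definition cobd :: "(nat set \<Rightarrow> rat) \<Rightarrow> nat set \<Rightarrow> rat" where
  "cobd \<phi> \<eta> = (\<Sum>v\<in>\<eta>. vsign (\<eta> - {v}) v * \<phi> (\<eta> - {v}))"

lemma sum_mult_bd:
  assumes "chain K (Suc j) d"
  shows "(\<Sum>\<sigma>\<in>faces K j. \<phi> \<sigma> * bd K (Suc j) d \<sigma>) = (\<Sum>\<eta>\<in>faces K (Suc j). cobd \<phi> \<eta> * d \<eta>)"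
proof -
  have "(\<Sum>\<sigma>\<in>faces K j. \<phi> \<sigma> * bd K (Suc j) d \<sigma>)
      = (\<Sum>\<sigma>\<in>faces K j. \<Sum>v\<in>ext K \<sigma>. \<phi> \<sigma> * (vsign \<sigma> v * d (insert v \<sigma>)))"
    by (intro sum.cong) (auto simp: bd_eq[OF assms] sum_distrib_left)
  also have "\<dots> = (\<Sum>\<eta>\<in>faces K (Suc j). cobd \<phi> \<eta> * d \<eta>)"
    unfolding flag_sum cobd_def sum_distrib_right
    by (intro sum.cong) (auto simp: insert_absorb)
  finally show ?thesis .
qed

text \<open>The graph of the link of \<open>\<tau>\<close> has vertex set \<open>ext K \<tau>\<close>, and \<open>v\<close> has degree \<open>card (ext K (insert v \<tau>))\<close>.
  The inequality says that its normalised Laplacian has spectral gap at least \<open>1 - \<kappa>\<close>.\<close>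
definition link_gap :: "real \<Rightarrow> nat set \<Rightarrow> bool" where
  "link_gap \<kappa> \<tau> \<longleftrightarrow> (\<forall>f :: nat \<Rightarrow> real.
     (\<Sum>v\<in>ext K \<tau>. real (card (ext K (insert v \<tau>))) * f v) = 0 \<longrightarrow>
     (\<Sum>v\<in>ext K \<tau>. \<Sum>u\<in>ext K (insert v \<tau>). f v * f u)
       \<le> \<kappa> * (\<Sum>v\<in>ext K \<tau>. real (card (ext K (insert v \<tau>))) * (f v)\<^sup>2))"

text \<open>Sum the gap inequality over all \<tau>, applied to the signed restriction
  \<open>f \<tau>\<close> of \<phi> to the link of \<tau>. Coclosedness is exactly the orthogonality
  to constants that the gap asks for. With \<open>E\<close> the \<open>w\<close>-weighted energy of
  \<phi>, the left sides add up to \<open>E\<close> and the right sides to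
  \<open>\<kappa> * (real j + 2) * E\<close>, which forces \<open>E = 0\<close>.\<close>

lemma garland:
  assumes gap: "\<And>\<tau>. \<tau> \<in> faces K j \<Longrightarrow> link_gap \<kappa> \<tau>"
    and \<kappa>: "\<kappa> * (real j + 2) < 1"
    and coface: "\<And>\<sigma>. \<sigma> \<in> faces K (Suc j) \<Longrightarrow> ext K \<sigma> \<noteq> {}"
    and closed: "\<And>\<eta>. \<eta> \<in> faces K (Suc (Suc j)) \<Longrightarrow> cobd \<phi> \<eta> = 0"
    and coclosed: "\<And>\<tau>. \<tau> \<in> faces K j \<Longrightarrow>
       (\<Sum>v\<in>ext K \<tau>. vsign \<tau> v * (of_nat (card (ext K (insert v \<tau>))) * \<phi> (insert v \<tau>))) = 0"
    and \<sigma>: "\<sigma> \<in> faces K (Suc j)"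
  shows "\<phi> \<sigma> = 0"
proof -
  define w where "w \<sigma> = real (card (ext K \<sigma>))" for \<sigma>
  define \<psi> where "\<psi> \<sigma> = real_of_rat (\<phi> \<sigma>)" for \<sigma>
  define sg where "sg \<tau> v = real_of_rat (vsign \<tau> v)" for \<tau> v
  have sg1: "sg \<tau> v * sg \<tau> v = 1" for \<tau> v
    unfolding sg_def by (simp flip: of_rat_mult)
  have sg2: "(sg \<tau> v)\<^sup>2 = 1" for \<tau> v using sg1 by (simp add: power2_eq_square)
  define f where "f \<tau> v = sg \<tau> v * \<psi> (insert v \<tau>)" for \<tau> v
  define E where "E = (\<Sum>\<sigma>\<in>faces K (Suc j). w \<sigma> * (\<psi> \<sigma>)\<^sup>2)"
  have rhs: "(\<Sum>\<tau>\<in>faces K j. \<Sum>v\<in>ext K \<tau>. w (insert v \<tau>) * (f \<tau> v)\<^sup>2) = (real j + 2) * E"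
  proof -
    have "(\<Sum>\<tau>\<in>faces K j. \<Sum>v\<in>ext K \<tau>. w (insert v \<tau>) * (f \<tau> v)\<^sup>2)
        = (\<Sum>\<tau>\<in>faces K j. \<Sum>v\<in>ext K \<tau>. w (insert v \<tau>) * (\<psi> (insert v \<tau>))\<^sup>2)"
      by (simp add: f_def power_mult_distrib sg2)
    also have "\<dots> = (\<Sum>\<sigma>\<in>faces K (Suc j). \<Sum>v\<in>\<sigma>. w \<sigma> * (\<psi> \<sigma>)\<^sup>2)"
      unfolding flag_sum by (intro sum.cong) (auto simp: insert_absorb)
    also have "\<dots> = (real j + 2) * E"
      unfolding E_def sum_distrib_left by (intro sum.cong) (auto simp: faces_def)
    finally show ?thesis .
  qed
  have lhs: "(\<Sum>\<tau>\<in>faces K j. \<Sum>v\<in>ext K \<tau>. \<Sum>u\<in>ext K (insert v \<tau>). f \<tau> v * f \<tau> u) = E"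
  proof -
    have "(\<Sum>\<tau>\<in>faces K j. \<Sum>v\<in>ext K \<tau>. \<Sum>u\<in>ext K (insert v \<tau>). f \<tau> v * f \<tau> u)
        = (\<Sum>\<sigma>\<in>faces K (Suc j). \<Sum>v\<in>\<sigma>. \<Sum>u\<in>ext K \<sigma>. f (\<sigma> - {v}) v * f (\<sigma> - {v}) u)"
      unfolding flag_sum by (intro sum.cong) (auto simp: insert_absorb)
    also have "\<dots> = (\<Sum>\<sigma>\<in>faces K (Suc j). \<Sum>u\<in>ext K \<sigma>. \<Sum>v\<in>\<sigma>. f (\<sigma> - {v}) v * f (\<sigma> - {v}) u)"
      by (intro sum.cong refl sum.swap)
    \<comment> \<open>An edge of a link is a face two dimensions above \<tau> with an ordered pair
      of distinct marked vertices.\<close>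
    also have "\<dots> = (\<Sum>\<eta>\<in>faces K (Suc (Suc j)). \<Sum>u\<in>\<eta>. \<Sum>v\<in>\<eta> - {u}.
                       f (\<eta> - {u} - {v}) v * f (\<eta> - {u} - {v}) u)"
      unfolding flag_sum ..
    also have "\<dots> = (\<Sum>\<eta>\<in>faces K (Suc (Suc j)). \<Sum>v\<in>\<eta>. (\<psi> (\<eta> - {v}))\<^sup>2)"
    proof (rule sum.cong[OF refl])
      fix \<eta> assume \<eta>: "\<eta> \<in> faces K (Suc (Suc j))"
      then have fin: "finite \<eta>" by (rule finite_faceD)
      define x where "x v = sg (\<eta> - {v}) v * \<psi> (\<eta> - {v})" for v
      have x2: "x v * x v = (\<psi> (\<eta> - {v}))\<^sup>2" for v
        by (simp add: x_def power2_eq_square algebra_simps)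
           (simp add: sg1 flip: mult.assoc)
      \<comment> \<open>Closedness at \<eta>: the signed values on its facets sum to zero. Hence the
        products \<open>x u * x v\<close> with distinct \<open>u\<close>, \<open>v\<close> add up to
        minus the sum of the squares, and the minus sign in \<open>neg\<close> leaves only
        squares.\<close>
      have x0: "sum x \<eta> = 0"
        using closed[OF \<eta>, THEN arg_cong[where f = real_of_rat]]
        by (simp add: cobd_def x_def sg_def \<psi>_def of_rat_sum of_rat_mult)
      have neg: "f (\<eta> - {u} - {v}) v * f (\<eta> - {u} - {v}) u = - (x u * x v)"
        if "u \<in> \<eta>" "v \<in> \<eta> - {u}" for u v
      proof -
        define \<tau> where "\<tau> = \<eta> - {u} - {v}"
        have ins: "\<eta> - {u} = insert v \<tau>" "\<eta> - {v} = insert u \<tau>"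
          using that by (auto simp: \<tau>_def)
        have "sg (insert v \<tau>) u * sg (insert u \<tau>) v = - (sg \<tau> u * sg \<tau> v)"
          unfolding sg_def of_rat_mult[symmetric]
          by (subst vsign_swap_insert) (use that fin in \<open>auto simp: \<tau>_def of_rat_minus\<close>)
        then have "x u * x v = - (sg \<tau> u * sg \<tau> v) * (\<psi> (insert v \<tau>) * \<psi> (insert u \<tau>))"
          unfolding x_def ins by (metis (no_types, lifting) mult.assoc mult.commute)
        then show ?thesis unfolding f_def \<tau>_def[symmetric] by simp
      qed
      have "(\<Sum>u\<in>\<eta>. \<Sum>v\<in>\<eta> - {u}. f (\<eta> - {u} - {v}) v * f (\<eta> - {u} - {v}) u)
          = (\<Sum>u\<in>\<eta>. \<Sum>v\<in>\<eta> - {u}. - (x u * x v))"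
        by (intro sum.cong refl neg)
      also have "\<dots> = (\<Sum>u\<in>\<eta>. x u * x u - x u * sum x \<eta>)"
        by (intro sum.cong refl)
           (simp add: sum_negf sum_diff1 fin right_diff_distrib flip: sum_distrib_left)
      also have "\<dots> = (\<Sum>v\<in>\<eta>. (\<psi> (\<eta> - {v}))\<^sup>2)"
        by (simp add: x0 x2)
      finally show "(\<Sum>u\<in>\<eta>. \<Sum>v\<in>\<eta> - {u}. f (\<eta> - {u} - {v}) v * f (\<eta> - {u} - {v}) u)
          = (\<Sum>v\<in>\<eta>. (\<psi> (\<eta> - {v}))\<^sup>2)" .
    qed
    also have "\<dots> = (\<Sum>\<sigma>\<in>faces K (Suc j). \<Sum>v\<in>ext K \<sigma>. (\<psi> \<sigma>)\<^sup>2)"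
      unfolding flag_sum ..
    also have "\<dots> = E" by (simp add: E_def w_def)
    finally show ?thesis .
  qed
  have "(\<Sum>\<tau>\<in>faces K j. \<Sum>v\<in>ext K \<tau>. \<Sum>u\<in>ext K (insert v \<tau>). f \<tau> v * f \<tau> u)
      \<le> (\<Sum>\<tau>\<in>faces K j. \<kappa> * (\<Sum>v\<in>ext K \<tau>. w (insert v \<tau>) * (f \<tau> v)\<^sup>2))"
  proof (rule sum_mono)
    fix \<tau> assume \<tau>: "\<tau> \<in> faces K j"
    have "(\<Sum>v\<in>ext K \<tau>. w (insert v \<tau>) * f \<tau> v) = 0"
      using coclosed[OF \<tau>, THEN arg_cong[where f = real_of_rat]]
      by (simp add: w_def f_def sg_def \<psi>_def of_rat_sum of_rat_mult mult.left_commute)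
    with gap[OF \<tau>]
    show "(\<Sum>v\<in>ext K \<tau>. \<Sum>u\<in>ext K (insert v \<tau>). f \<tau> v * f \<tau> u)
      \<le> \<kappa> * (\<Sum>v\<in>ext K \<tau>. w (insert v \<tau>) * (f \<tau> v)\<^sup>2)"
      unfolding link_gap_def w_def by blast
  qed
  then have "E \<le> \<kappa> * ((real j + 2) * E)"
    using lhs rhs by (simp only: sum_distrib_left[of \<kappa>, symmetric])
  then have "(1 - \<kappa> * (real j + 2)) * E \<le> 0" by (simp add: algebra_simps)
  with \<kappa> have "E \<le> 0" by (simp add: mult_le_0_iff)
  moreover have "0 \<le> w \<sigma> * (\<psi> \<sigma>)\<^sup>2" for \<sigma> by (simp add: w_def)
  moreover from this have "E \<ge> 0" unfolding E_def by (intro sum_nonneg)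
  ultimately have "w \<sigma> * (\<psi> \<sigma>)\<^sup>2 = 0"
    using \<sigma> sum_nonneg_eq_0_iff[of "faces K (Suc j)" "\<lambda>\<sigma>. w \<sigma> * (\<psi> \<sigma>)\<^sup>2"]
    unfolding E_def by simp
  moreover have "w \<sigma> \<noteq> 0" using coface[OF \<sigma>] by (simp add: w_def)
  ultimately show ?thesis by (simp add: \<psi>_def)
qed

text \<open>Here \<open>c'\<close> is the cycle minus its \<open>1 / w\<close>-orthogonal projection
  onto the boundaries, and \<phi> is \<open>c'\<close> divided by \<open>w\<close>. Orthogonality to
  boundaries says that \<phi> is closed; being a cycle says that \<phi> is coclosed, since the
  weight there cancels the division. \<open>garland\<close> then gives \<open>c' = 0\<close>, so
  \<open>c\<close> is the subtracted boundary.\<close>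

theorem homology_vanishes_if_link_gap:
  assumes gap: "\<And>\<tau>. \<tau> \<in> faces K j \<Longrightarrow> link_gap \<kappa> \<tau>"
    and \<kappa>: "\<kappa> * (real j + 2) < 1"
    and coface: "\<And>\<sigma>. \<sigma> \<in> faces K (Suc j) \<Longrightarrow> ext K \<sigma> \<noteq> {}"
  shows "homology_vanishes K (Suc j)"
  unfolding homology_vanishes_def
proof (intro allI impI)
  fix c assume c: "chain K (Suc j) c \<and> bd K (Suc j) c = (\<lambda>_. 0)"
  let ?F = "faces K (Suc j)" and ?G = "faces K (Suc (Suc j))"
  define w :: "nat set \<Rightarrow> rat" where "w \<sigma> = of_nat (card (ext K \<sigma>))" for \<sigma>
  have w: "w \<sigma> > 0" if "\<sigma> \<in> ?F" for \<sigma>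
    using coface[OF that] by (simp add: w_def card_gt_0_iff)
  \<comment> \<open>Elementary chains: their boundaries span all boundaries, and pairing with
    \<open>e \<eta>\<close> evaluates a coboundary at \<eta>.\<close>
  define e where "e = (\<lambda>\<eta> \<eta>'::nat set. if \<eta>' = \<eta> then 1 else 0 :: rat)"
  have e: "chain K (Suc (Suc j)) (e \<eta>)" if "\<eta> \<in> ?G" for \<eta>
    using that by (auto simp: chain_def e_def)
  obtain d0 where d0: "\<forall>\<eta>\<in>?G. (\<Sum>\<sigma>\<in>?F. 1 / w \<sigma> *
      (c \<sigma> - (\<Sum>\<theta>\<in>?G. d0 \<theta> * bd K (Suc (Suc j)) (e \<theta>) \<sigma>)) * bd K (Suc (Suc j)) (e \<eta>) \<sigma>) = 0"
    using exists_orthogonal_residual[of ?F "\<lambda>\<sigma>. 1 / w \<sigma>" ?G c "\<lambda>\<eta>. bd K (Suc (Suc j)) (e \<eta>)"] w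
    by auto
  define d where "d \<eta> = (if \<eta> \<in> ?G then d0 \<eta> else 0)" for \<eta>
  have d: "chain K (Suc (Suc j)) d" by (simp add: chain_def d_def)
  have bd_d: "bd K (Suc (Suc j)) d \<sigma> = (\<Sum>\<theta>\<in>?G. d0 \<theta> * bd K (Suc (Suc j)) (e \<theta>) \<sigma>)"
    if \<sigma>: "\<sigma> \<in> ?F" for \<sigma>
  proof -
    have "d (insert v \<sigma>) = (\<Sum>\<theta>\<in>?G. d0 \<theta> * e \<theta> (insert v \<sigma>))" for v
      by (simp add: d_def e_def if_distrib[of "\<lambda>x. _ * x"] cong: if_cong)
    then have "bd K (Suc (Suc j)) d \<sigma> =
        (\<Sum>v\<in>ext K \<sigma>. \<Sum>\<theta>\<in>?G. vsign \<sigma> v * (d0 \<theta> * e \<theta> (insert v \<sigma>)))"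
      by (simp add: bd_eq[OF d \<sigma>] sum_distrib_left)
    also have "\<dots> = (\<Sum>\<theta>\<in>?G. \<Sum>v\<in>ext K \<sigma>. vsign \<sigma> v * (d0 \<theta> * e \<theta> (insert v \<sigma>)))"
      by (rule sum.swap)
    also have "\<dots> = (\<Sum>\<theta>\<in>?G. d0 \<theta> * bd K (Suc (Suc j)) (e \<theta>) \<sigma>)"
      by (intro sum.cong) (auto simp: bd_eq[OF e \<sigma>] sum_distrib_left mult.left_commute)
    finally show ?thesis .
  qed
  define c' where "c' \<sigma> = c \<sigma> - bd K (Suc (Suc j)) d \<sigma>" for \<sigma>
  have chain_c': "chain K (Suc j) c'"
    using c chain_bd[of "Suc j" d] by (simp add: chain_def c'_def)
  define \<phi> where "\<phi> \<sigma> = c' \<sigma> / w \<sigma>" for \<sigma>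
  have "\<phi> \<sigma> = 0" if "\<sigma> \<in> ?F" for \<sigma>
  proof (rule garland[OF gap \<kappa> coface _ _ that])
    fix \<eta> assume \<eta>: "\<eta> \<in> ?G"
    have "cobd \<phi> \<eta> = (\<Sum>\<theta>\<in>?G. cobd \<phi> \<theta> * e \<eta> \<theta>)"
      using \<eta> by (simp add: e_def if_distrib[of "\<lambda>x. _ * x"] cong: if_cong)
    also have "\<dots> = (\<Sum>\<sigma>\<in>?F. \<phi> \<sigma> * bd K (Suc (Suc j)) (e \<eta>) \<sigma>)"
      by (rule sum_mult_bd[OF e[OF \<eta>], symmetric])
    also have "\<dots> = 0"
      using d0[rule_format, OF \<eta>] by (simp add: \<phi>_def c'_def bd_d cong: sum.cong)
    finally show "cobd \<phi> \<eta> = 0" .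
  next
    fix \<tau> assume \<tau>: "\<tau> \<in> faces K j"
    have "(\<Sum>v\<in>ext K \<tau>. vsign \<tau> v * (of_nat (card (ext K (insert v \<tau>))) * \<phi> (insert v \<tau>)))
        = (\<Sum>v\<in>ext K \<tau>. vsign \<tau> v * c' (insert v \<tau>))"
    proof (rule sum.cong[OF refl])
      fix v assume "v \<in> ext K \<tau>"
      then have "w (insert v \<tau>) \<noteq> 0" using w[OF insert_ext_faces[OF \<tau>]] by force
      then show "vsign \<tau> v * (of_nat (card (ext K (insert v \<tau>))) * \<phi> (insert v \<tau>))
          = vsign \<tau> v * c' (insert v \<tau>)"
        by (simp add: \<phi>_def flip: w_def)
    qed
    also have "\<dots> = (\<Sum>v\<in>ext K \<tau>. vsign \<tau> v * c (insert v \<tau>))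
        - (\<Sum>v\<in>ext K \<tau>. vsign \<tau> v * bd K (Suc (Suc j)) d (insert v \<tau>))"
      by (simp add: c'_def right_diff_distrib sum_subtractf)
    also have "\<dots> = bd K (Suc j) c \<tau> - bd K (Suc j) (bd K (Suc (Suc j)) d) \<tau>"
      by (simp add: bd_eq[OF c[THEN conjunct1] \<tau>] bd_eq[OF chain_bd \<tau>])
    also have "\<dots> = 0" using c bd_bd[OF d] by simp
    finally show "(\<Sum>v\<in>ext K \<tau>. vsign \<tau> v *
        (of_nat (card (ext K (insert v \<tau>))) * \<phi> (insert v \<tau>))) = 0" .
  qed auto
  then have "c' \<sigma> = 0" if "\<sigma> \<in> ?F" for \<sigma>
    using w[OF that] that by (fastforce simp: \<phi>_def)
  moreover have "c' \<sigma> = 0" if "\<sigma> \<notin> ?F" for \<sigma>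
    using chain_c' that by (simp add: chain_def)
  ultimately have "bd K (Suc (Suc j)) d = c"
    unfolding c'_def by (metis eq_iff_diff_eq_0 ext)
  with d show "\<exists>d. chain K (Suc j + 1) d \<and> bd K (Suc j + 1) d = c"
    by auto
qed

end

section \<open>Matrix powers and walks\<close>

primrec mpow :: "('a \<Rightarrow> 'a \<Rightarrow> real) \<Rightarrow> 'a set \<Rightarrow> nat \<Rightarrow> 'a \<Rightarrow> 'a \<Rightarrow> real" where
  "mpow M W 0 u v = of_bool (u = v)"
| "mpow M W (Suc k) u v = (\<Sum>x\<in>W. M u x * mpow M W k x v)"

definition mapply :: "('a \<Rightarrow> 'a \<Rightarrow> real) \<Rightarrow> 'a set \<Rightarrow> ('a \<Rightarrow> real) \<Rightarrow> 'a \<Rightarrow> real" where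
  "mapply M W f u = (\<Sum>v\<in>W. M u v * f v)"

fun walk_weight :: "('a \<Rightarrow> 'a \<Rightarrow> real) \<Rightarrow> 'a list \<Rightarrow> real" where
  "walk_weight M (x # y # ys) = M x y * walk_weight M (y # ys)"
| "walk_weight M _ = 1"

context
  fixes W :: "'a set" and M :: "'a \<Rightarrow> 'a \<Rightarrow> real"
  assumes W: "finite W"
begin

lemma mapply_funpow:
  "u \<in> W \<Longrightarrow> (mapply M W ^^ k) f u = (\<Sum>v\<in>W. mpow M W k u v * f v)"
proof (induction k arbitrary: u)
  case 0
  then show ?case using W by (simp add: of_bool_def if_distrib[of "\<lambda>x. x * _"] cong: if_cong)
next
  case (Suc k)
  have "(mapply M W ^^ Suc k) f u = (\<Sum>x\<in>W. \<Sum>v\<in>W. M u x * mpow M W k x v * f v)"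
    by (simp add: mapply_def[of M W _ u] Suc.IH sum_distrib_left mult.assoc)
  also have "\<dots> = (\<Sum>v\<in>W. mpow M W (Suc k) u v * f v)"
    by (subst sum.swap) (simp add: sum_distrib_right)
  finally show ?case .
qed

lemma mpow_add:
  "u \<in> W \<Longrightarrow> mpow M W (a + b) u v = (\<Sum>x\<in>W. mpow M W a u x * mpow M W b x v)"
proof (induction a arbitrary: u)
  case 0
  then show ?case using W by (simp add: of_bool_def if_distrib[of "\<lambda>x. x * _"] cong: if_cong)
next
  case (Suc a)
  have "mpow M W (Suc a + b) u v = (\<Sum>y\<in>W. \<Sum>x\<in>W. M u y * mpow M W a y x * mpow M W b x v)"
    by (simp add: Suc.IH sum_distrib_left mult.assoc)
  also have "\<dots> = (\<Sum>x\<in>W. mpow M W (Suc a) u x * mpow M W b x v)"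
    by (subst sum.swap) (simp add: sum_distrib_right)
  finally show ?case .
qed

lemma mpow_walks:
  "mpow M W L u v = (\<Sum>xs | set xs \<subseteq> W \<and> length xs = L. of_bool (last (u # xs) = v) * walk_weight M (u # xs))"
proof (induction L arbitrary: u)
  case 0
  have "{xs. set xs \<subseteq> W \<and> length xs = 0} = {[]}" by auto
  then show ?case by simp
next
  case (Suc L)
  let ?A = "{xs. set xs \<subseteq> W \<and> length xs = L}"
  have "(\<Sum>xs | set xs \<subseteq> W \<and> length xs = Suc L. of_bool (last (u # xs) = v) * walk_weight M (u # xs))
      = (\<Sum>(xs, x)\<in>?A \<times> W. of_bool (last (u # x # xs) = v) * walk_weight M (u # x # xs))"
    unfolding lists_length_Suc_eq
    by (subst sum.reindex) (auto simp: inj_on_def case_prod_unfold)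
  also have "\<dots> = (\<Sum>xs\<in>?A. \<Sum>x\<in>W. of_bool (last (u # x # xs) = v) * walk_weight M (u # x # xs))"
    by (rule sum.cartesian_product[symmetric])
  also have "\<dots> = (\<Sum>x\<in>W. \<Sum>xs\<in>?A. M u x * (of_bool (last (x # xs) = v) * walk_weight M (x # xs)))"
    by (subst sum.swap) (simp add: mult.left_commute)
  finally show ?case by (simp add: Suc.IH sum_distrib_left)
qed

text \<open>Closed walks of \<open>L\<close> steps are listed with the starting point repeated at
  the end, whence \<open>Suc L\<close> entries.\<close>

lemma trace_walks:
  "(\<Sum>u\<in>W. mpow M W L u u) = (\<Sum>ys | set ys \<subseteq> W \<and> length ys = Suc L.
     of_bool (last ys = hd ys) * walk_weight M ys)"
proof -
  let ?A = "{xs. set xs \<subseteq> W \<and> length xs = L}"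
  have "(\<Sum>ys | set ys \<subseteq> W \<and> length ys = Suc L. of_bool (last ys = hd ys) * walk_weight M ys)
     = (\<Sum>(xs, x)\<in>?A \<times> W. of_bool (last (x # xs) = x) * walk_weight M (x # xs))"
    unfolding lists_length_Suc_eq
    by (subst sum.reindex) (auto simp: inj_on_def case_prod_unfold)
  also have "\<dots> = (\<Sum>x\<in>W. \<Sum>xs\<in>?A. of_bool (last (x # xs) = x) * walk_weight M (x # xs))"
    by (subst sum.cartesian_product[symmetric]) (rule sum.swap)
  finally show ?thesis by (simp add: mpow_walks)
qed

context
  assumes sym: "\<And>u v. M u v = M v u"
begin

lemma mpow_sym: "u \<in> W \<Longrightarrow> v \<in> W \<Longrightarrow> mpow M W k u v = mpow M W k v u"
proof (induction k arbitrary: u v)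
  case (Suc k)
  have "mpow M W (k + 1) v u = (\<Sum>x\<in>W. mpow M W k v x * mpow M W 1 x u)"
    by (rule mpow_add[OF Suc.prems(2)])
  also have "\<dots> = (\<Sum>x\<in>W. M u x * mpow M W k x v)"
    using Suc W sym by (intro sum.cong)
      (auto simp: of_bool_def if_distrib[of "\<lambda>x. _ * x"] cong: if_cong)
  finally show ?case by simp
qed auto

text \<open>By symmetry the 2k-th power is the k-th power times its transpose, so its trace is a
  squared Frobenius norm.\<close>

lemma trace_even:
  "(\<Sum>u\<in>W. mpow M W (2 * k) u u) = (\<Sum>u\<in>W. \<Sum>v\<in>W. (mpow M W k u v)\<^sup>2)"
proof (rule sum.cong[OF refl])
  fix u assume u: "u \<in> W"
  show "mpow M W (2 * k) u u = (\<Sum>v\<in>W. (mpow M W k u v)\<^sup>2)"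
    unfolding mult_2 mpow_add[OF u] using mpow_sym[OF u]
    by (intro sum.cong) (auto simp: power2_eq_square)
qed

lemma trace_even_nonneg: "0 \<le> (\<Sum>u\<in>W. mpow M W (2 * k) u u)"
  unfolding trace_even by (intro sum_nonneg) auto

lemma mapply_adjoint: "(\<Sum>u\<in>W. mapply M W f u * g u) = (\<Sum>u\<in>W. f u * mapply M W g u)"
  unfolding mapply_def sum_distrib_left sum_distrib_right
  by (subst sum.swap) (simp add: sym[of _ "_::'a"] mult_ac)

text \<open>This bounds the top eigenvalue by the 2k-th root of the trace without diagonalising. The
  squared norms \<open>b i\<close> of the iterates of \<open>f\<close> are log-convex, by
  self-adjointness and Cauchy-Schwarz, and \<open>b k\<close> is controlled by the Frobenius norm of
  the k-th power.\<close>

lemma quadratic_form_le_trace: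
  assumes tr: "(\<Sum>u\<in>W. mpow M W (2 * k) u u) \<le> \<Theta> ^ (2 * k)" and k: "k > 0" and \<Theta>: "\<Theta> \<ge> 0"
  shows "(\<Sum>u\<in>W. f u * mapply M W f u) \<le> \<Theta> * (\<Sum>u\<in>W. (f u)\<^sup>2)"
proof -
  define g where "g i = (mapply M W ^^ i) f" for i
  have g_Suc: "g (Suc i) = mapply M W (g i)" for i by (simp add: g_def)
  define b where "b i = (\<Sum>u\<in>W. (g i u)\<^sup>2)" for i
  have b0: "b i \<ge> 0" for i unfolding b_def by (intro sum_nonneg) auto
  have cs: "(b (Suc i))\<^sup>2 \<le> b i * b (Suc (Suc i))" for i
  proof -
    have "b (Suc i) = (\<Sum>u\<in>W. mapply M W (g i) u * g (Suc i) u)"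
      by (simp add: b_def g_Suc power2_eq_square)
    also have "\<dots> = (\<Sum>u\<in>W. g i u * g (Suc (Suc i)) u)"
      unfolding g_Suc[of "Suc i"] by (rule mapply_adjoint)
    finally show ?thesis unfolding b_def by (simp only: Cauchy_Schwarz_ineq_sum)
  qed
  have bk: "b k \<le> \<Theta> ^ (2 * k) * b 0"
  proof -
    have "b k \<le> (\<Sum>u\<in>W. (\<Sum>v\<in>W. (mpow M W k u v)\<^sup>2) * (\<Sum>v\<in>W. (f v)\<^sup>2))"
      unfolding b_def
    proof (rule sum_mono)
      fix u assume "u \<in> W"
      then show "(g k u)\<^sup>2 \<le> (\<Sum>v\<in>W. (mpow M W k u v)\<^sup>2) * (\<Sum>v\<in>W. (f v)\<^sup>2)"
        unfolding g_def mapply_funpow[OF \<open>u \<in> W\<close>] by (intro Cauchy_Schwarz_ineq_sum)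
    qed
    also have "\<dots> = (\<Sum>u\<in>W. mpow M W (2 * k) u u) * b 0"
      unfolding trace_even by (simp add: b_def g_def sum_distrib_right)
    also have "\<dots> \<le> \<Theta> ^ (2 * k) * b 0" by (intro mult_right_mono tr b0)
    finally show ?thesis .
  qed
  have b1: "b 1 \<le> \<Theta>\<^sup>2 * b 0"
  proof (cases "b 0 = 0")
    case True
    have "(b 1)\<^sup>2 \<le> 0"
    proof -
      have "\<forall>u\<in>W. f u = 0"
        using True W unfolding b_def g_def by (simp add: sum_nonneg_eq_0_iff)
      then have "b 1 = 0" by (simp add: b_def g_def mapply_def)
      then show ?thesis by simp
    qed
    then show ?thesis using True by simp
  next
    case False
    then have pos: "b 0 > 0" using b0[of 0] by linarith
    \<comment> \<open>Log-convexity makes successive ratios of \<open>b\<close> nondecreasing, so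
      the first ratio \<open>r\<close> satisfies \<open>r ^ k * b 0 \<le> b k\<close>. That bounds
      \<open>r\<close> by \<open>\<Theta>\<^sup>2\<close>.\<close>
    define r where "r = b 1 / b 0"
    have r0: "r \<ge> 0" using b0[of 1] pos by (simp add: r_def)
    have step: "r * b i \<le> b (Suc i)" for i
    proof (induction i)
      case 0
      then show ?case using pos by (simp add: r_def)
    next
      case (Suc i)
      show ?case
      proof (cases "b (Suc i) = 0")
        case True
        then show ?thesis using b0 by simp
      next
        case False
        then have p1: "b (Suc i) > 0" using b0[of "Suc i"] by linarith
        then have "0 < b i * b (Suc (Suc i))" using cs[of i] by (smt (verit) zero_less_power)
        then have p0: "b i > 0" using b0[of i] by (simp add: zero_less_mult_iff)
        have "b i * (r * b (Suc i)) \<le> (b (Suc i))\<^sup>2"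
          using mult_right_mono[OF Suc.IH less_imp_le[OF p1]]
          by (simp add: power2_eq_square mult_ac)
        also have "\<dots> \<le> b i * b (Suc (Suc i))" by (rule cs)
        finally show ?thesis using p0 by simp
      qed
    qed
    have "r ^ i * b 0 \<le> b i" for i
    proof (induction i)
      case (Suc i)
      have "r ^ Suc i * b 0 = r * (r ^ i * b 0)" by simp
      also have "\<dots> \<le> r * b i" by (intro mult_left_mono Suc r0)
      also have "\<dots> \<le> b (Suc i)" by (rule step)
      finally show ?case .
    qed simp
    from order_trans[OF this[of k] bk] have "r ^ k \<le> (\<Theta>\<^sup>2) ^ k"
      using pos by (simp add: power_mult)
    then have "r \<le> \<Theta>\<^sup>2" using power_le_imp_le_base[of r "k - 1" "\<Theta>\<^sup>2"] k by simp
    then show ?thesis using pos by (simp add: r_def field_simps)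
  qed
  have "(\<Sum>u\<in>W. f u * mapply M W f u)\<^sup>2 \<le> b 0 * b 1"
    unfolding b_def g_def by (simp add: Cauchy_Schwarz_ineq_sum)
  also have "\<dots> \<le> b 0 * (\<Theta>\<^sup>2 * b 0)" by (intro mult_left_mono b1 b0)
  also have "\<dots> = (\<Theta> * b 0)\<^sup>2" by (simp add: power2_eq_square)
  finally have "(\<Sum>u\<in>W. f u * mapply M W f u) \<le> \<Theta> * b 0"
    by (rule power2_le_imp_le) (use \<Theta> b0 in auto)
  then show ?thesis by (simp add: b_def g_def)
qed

end

end

section \<open>Supports of walks and a crude count of walks with few vertices\<close>

fun walk_edges :: "'a list \<Rightarrow> 'a set list" where
  "walk_edges (x # y # ys) = {x, y} # walk_edges (y # ys)"
| "walk_edges _ = []"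

lemma length_walk_edges: "length (walk_edges ys) = length ys - 1"
  by (induction ys rule: walk_edges.induct) auto

lemma walk_edges_subset: "e \<in> set (walk_edges ys) \<Longrightarrow> e \<subseteq> set ys"
  by (induction ys rule: walk_edges.induct) auto

text \<open>The support of a walk is a connected graph: prepending a new vertex also creates a new
  edge.\<close>

lemma card_set_le_walk_edges: "card (set ys) \<le> Suc (card (set (walk_edges ys)))"
proof (induction ys rule: walk_edges.induct)
  case (1 x y ys)
  show ?case
  proof (cases "x \<in> set (y # ys)")
    case True
    then have "card (set (x # y # ys)) = card (set (y # ys))" by (simp add: insert_absorb)
    also have "\<dots> \<le> Suc (card (set (walk_edges (x # y # ys))))"
      by (rule order_trans[OF 1]) (simp add: card_insert_le)
    finally show ?thesis .
  next
    case False
    then have "{x, y} \<notin> set (walk_edges (y # ys))" using walk_edges_subset by fastforce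
    then have "card (set (walk_edges (x # y # ys))) = Suc (card (set (walk_edges (y # ys))))" by simp
    moreover have "card (set (x # y # ys)) = Suc (card (set (y # ys)))" using False by simp
    ultimately show ?thesis using 1 by linarith
  qed
qed auto

lemma prod_list_map_count: "prod_list (map f xs) = (\<Prod>x\<in>set xs. f x ^ count_list xs x)"
  for f :: "'a \<Rightarrow> 'b::comm_monoid_mult"
proof (induction xs)
  case (Cons a xs)
  show ?case
  proof (cases "a \<in> set xs")
    case True
    have "(\<Prod>x\<in>set xs. f x ^ count_list (a # xs) x) = (\<Prod>x\<in>set xs. (if x = a then f x else 1) * f x ^ count_list xs x)"
      by (intro prod.cong) auto
    also have "\<dots> = f a * (\<Prod>x\<in>set xs. f x ^ count_list xs x)"
      using True by (simp add: prod.distrib)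
    finally show ?thesis using True Cons by (simp add: insert_absorb)
  next
    case False
    have "(\<Prod>x\<in>set xs. f x ^ count_list (a # xs) x) = (\<Prod>x\<in>set xs. f x ^ count_list xs x)"
      using False by (intro prod.cong) auto
    then show ?thesis using False Cons by simp
  qed
qed simp

text \<open>Separates vertex indicators from edge factors with multiplicities, the shape in which
  independence applies. A one-point list has weight 1 whatever \<open>P\<close> says, hence the
  bound on the length.\<close>

lemma walk_weight_edges:
  assumes "\<And>u v. M u v = (if P u \<and> P v then h {u, v} else 0)" "length ys \<ge> 2"
  shows "walk_weight M ys = (\<Prod>v\<in>set ys. of_bool (P v)) * (\<Prod>e\<in>set (walk_edges ys). h e ^ count_list (walk_edges ys) e)"
proof -
  have "walk_weight M ys = (if \<forall>v\<in>set ys. P v then prod_list (map h (walk_edges ys)) else 0)"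
    using assms(2)
  proof (induction ys rule: walk_edges.induct)
    case (1 x y ys)
    then show ?case by (cases ys) (auto simp: assms(1))
  qed auto
  also have "\<dots> = (\<Prod>v\<in>set ys. of_bool (P v)) * prod_list (map h (walk_edges ys))"
    by (auto intro!: prod.neutral)
  finally show ?thesis by (simp only: prod_list_map_count)
qed

text \<open>Group the lists by their value set \<open>S\<close> of size s. There are at most N^s
  such sets and at most (k+1)^(L+1) lists on each, and N^s times the weight is N a (N a b)^(s-1),
  which is largest at s = k+1 because \<open>real (card W) * (a * b)\<close> is at least 1. Summing
  over k+1 sizes adds the last factor.\<close>

lemma count_lists_few_values:
  fixes a b :: real
  assumes W: "finite W" and a: "a \<ge> 0" and b: "b \<ge> 0" and ab: "real (card W) * (a * b) \<ge> 1"
  shows "(\<Sum>ys | set ys \<subseteq> W \<and> length ys = Suc L \<and> card (set ys) \<le> Suc k. a ^ card (set ys) * b ^ (card (set ys) - 1))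
     \<le> real (Suc k) ^ (L + 2) * (real (card W) * a) * (real (card W) * (a * b)) ^ k"
proof -
  let ?N = "real (card W)"
  define w where "w s = a ^ s * b ^ (s - 1)" for s
  have w0: "w s \<ge> 0" for s using a b by (simp add: w_def)
  define \<S> where "\<S> = {S. S \<subseteq> W \<and> card S \<in> {1..Suc k}}"
  have fS: "finite \<S>" using W by (simp add: \<S>_def)
  define Q where "Q S = {ys. set ys \<subseteq> S \<and> length ys = Suc L}" for S :: "'a set"
  have fQ: "finite (Q S)" "card (Q S) = card S ^ Suc L" if "finite S" for S
    using that by (simp_all only: Q_def finite_lists_length_eq card_lists_length_eq)
  have fin: "finite S" if "S \<in> \<S>" for S using that W finite_subset by (auto simp: \<S>_def)
  have "(\<Sum>ys | set ys \<subseteq> W \<and> length ys = Suc L \<and> card (set ys) \<le> Suc k. w (card (set ys)))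
     = (\<Sum>(S, ys)\<in>(\<lambda>ys. (set ys, ys)) ` {ys. set ys \<subseteq> W \<and> length ys = Suc L \<and> card (set ys) \<le> Suc k}. w (card S))"
    by (subst sum.reindex) (auto simp: inj_on_def)
  also have "\<dots> \<le> (\<Sum>(S, ys)\<in>Sigma \<S> Q. w (card S))"
  proof (rule sum_mono2)
    show "finite (Sigma \<S> Q)" using fS fQ fin by blast
    show "(\<lambda>ys. (set ys, ys)) ` {ys. set ys \<subseteq> W \<and> length ys = Suc L \<and> card (set ys) \<le> Suc k} \<subseteq> Sigma \<S> Q"
      by (auto simp: \<S>_def Q_def Suc_le_eq card_gt_0_iff)
  qed (auto simp: w0)
  also have "\<dots> = (\<Sum>S\<in>\<S>. real (card (Q S)) * w (card S))"
    by (subst sum.Sigma[symmetric]) (use fS fQ fin in auto)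
  also have "\<dots> \<le> (\<Sum>S\<in>\<S>. real (Suc k) ^ Suc L * w (card S))"
  proof (intro sum_mono mult_right_mono w0)
    fix S assume S: "S \<in> \<S>"
    then have "card S \<le> Suc k" by (simp add: \<S>_def)
    then show "real (card (Q S)) \<le> real (Suc k) ^ Suc L"
      unfolding fQ(2)[OF fin[OF S]] of_nat_power by (intro power_mono) auto
  qed
  also have "\<dots> = (\<Sum>s\<in>{1..Suc k}. \<Sum>S\<in>{S\<in>\<S>. card S = s}. real (Suc k) ^ Suc L * w (card S))"
    by (rule sum.group[symmetric]) (use fS in \<open>auto simp: \<S>_def\<close>)
  also have "\<dots> \<le> (\<Sum>s\<in>{1..Suc k}. real (Suc k) ^ Suc L * ((?N * a) * (?N * (a * b)) ^ k))"
  proof (rule sum_mono)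
    fix s assume s: "s \<in> {1..Suc k}"
    have "{S\<in>\<S>. card S = s} = {S. S \<subseteq> W \<and> card S = s}" using s by (auto simp: \<S>_def)
    then have "(\<Sum>S\<in>{S\<in>\<S>. card S = s}. real (Suc k) ^ Suc L * w (card S))
        = real (card W choose s) * (real (Suc k) ^ Suc L * w s)"
      using n_subsets[OF W, of s] by simp
    also have "\<dots> \<le> ?N ^ s * (real (Suc k) ^ Suc L * w s)"
    proof (intro mult_right_mono)
      show "real (card W choose s) \<le> ?N ^ s"
        using binomial_le_pow[of s "card W"] by (cases "s \<le> card W") (auto simp: binomial_eq_0 simp flip: of_nat_power)
    qed (use w0 in auto)
    also have "\<dots> = real (Suc k) ^ Suc L * ((?N * a) * (?N * (a * b)) ^ (s - 1))"
      using s by (cases s) (auto simp: w_def power_mult_distrib)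
    also have "\<dots> \<le> real (Suc k) ^ Suc L * ((?N * a) * (?N * (a * b)) ^ k)"
      using s a by (intro mult_left_mono power_increasing ab) auto
    finally show "(\<Sum>S\<in>{S\<in>\<S>. card S = s}. real (Suc k) ^ Suc L * w (card S))
        \<le> real (Suc k) ^ Suc L * ((?N * a) * (?N * (a * b)) ^ k)" .
  qed
  also have "\<dots> = real (Suc k) ^ (L + 2) * (?N * a) * (?N * (a * b)) ^ k"
    by simp
  finally show ?thesis by (simp add: w_def)
qed

section \<open>Products of independent blocks\<close>

lemma pmf_integrable_finite:
  fixes f :: "'a \<Rightarrow> real"
  shows "finite (set_pmf M) \<Longrightarrow> integrable (measure_pmf M) f"
  by (rule integrable_measure_pmf_finite)

lemma finite_set_Pi_pmf_bernoulli: "finite I \<Longrightarrow> finite (set_pmf (Pi_pmf I False (\<lambda>i. bernoulli_pmf (r i))))"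
  by (rule finite_subset[OF set_Pi_pmf_subset' finite_PiE_dflt]) auto

text \<open>The set \<open>A\<close> makes the induction go through: removing one block from the
  product leaves either \<open>A\<close> or \<open>A\<close> enlarged by that block as a set of
  required successes. The base case is independence of the single coordinates.\<close>

lemma expectation_prod_blocks_aux:
  fixes r :: "'i \<Rightarrow> real" and g :: "'s \<Rightarrow> bool \<Rightarrow> real"
  assumes "finite I" "\<And>i. i \<in> I \<Longrightarrow> 0 \<le> r i \<and> r i \<le> 1" "finite T"
    and "\<And>S. S \<in> T \<Longrightarrow> B S \<subseteq> I" "\<And>S S'. S \<in> T \<Longrightarrow> S' \<in> T \<Longrightarrow> S \<noteq> S' \<Longrightarrow> B S \<inter> B S' = {}"
    and "A \<subseteq> I" "\<And>S. S \<in> T \<Longrightarrow> A \<inter> B S = {}"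
  shows "measure_pmf.expectation (Pi_pmf I False (\<lambda>i. bernoulli_pmf (r i)))
      (\<lambda>X. of_bool (\<forall>i\<in>A. X i) * (\<Prod>S\<in>T. g S (\<forall>i\<in>B S. X i)))
    = (\<Prod>i\<in>A. r i) * (\<Prod>S\<in>T. g S True * (\<Prod>i\<in>B S. r i) + g S False * (1 - (\<Prod>i\<in>B S. r i)))"
  using assms(3-7)
proof (induction T arbitrary: A rule: finite_induct)
  case empty
  let ?f = "\<lambda>i b. if i \<in> A then of_bool b else 1 :: real"
  have finA: "finite A" using empty(3) assms(1) finite_subset by blast
  have IA: "(\<Prod>i\<in>I. if i \<in> A then h i else 1) = prod h A" for h :: "'i \<Rightarrow> real"
    using prod.inter_restrict[OF assms(1), of h A] Int_absorb1[OF empty(3)] by simp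
  have eq: "of_bool (\<forall>i\<in>A. X i) = (\<Prod>i\<in>I. ?f i (X i))" for X
  proof -
    have "(\<Prod>i\<in>I. ?f i (X i)) = (\<Prod>i\<in>A. of_bool (X i))"
      by (rule IA)
    also have "\<dots> = of_bool (\<forall>i\<in>A. X i)" using finA by auto
    finally show ?thesis ..
  qed
  have "measure_pmf.expectation (Pi_pmf I False (\<lambda>i. bernoulli_pmf (r i))) (\<lambda>X. of_bool (\<forall>i\<in>A. X i))
     = (\<Prod>i\<in>I. measure_pmf.expectation (bernoulli_pmf (r i)) (?f i))"
    unfolding eq by (rule expectation_prod_Pi_pmf[OF assms(1)]) (auto intro!: integrable_measure_pmf_finite)
  also have "\<dots> = (\<Prod>i\<in>I. if i \<in> A then r i else 1)"
    by (intro prod.cong refl) (simp add: assms(2))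
  also have "\<dots> = (\<Prod>i\<in>A. r i)" by (rule IA)
  finally show ?case by simp
next
  case (insert S T)
  let ?E = "measure_pmf.expectation (Pi_pmf I False (\<lambda>i. bernoulli_pmf (r i)))"
  let ?p = "\<Prod>i\<in>B S. r i"
  define F where "F X = (\<Prod>S\<in>T. g S (\<forall>i\<in>B S. X i))" for X :: "'i \<Rightarrow> bool"
  let ?R = "\<Prod>S\<in>T. g S True * (\<Prod>i\<in>B S. r i) + g S False * (1 - (\<Prod>i\<in>B S. r i))"
  note int = pmf_integrable_finite[OF finite_set_Pi_pmf_bernoulli[OF assms(1)]]
  have BS: "B S \<subseteq> I" "A \<inter> B S = {}"
    using insert.prems(1)[of S] insert.prems(4)[of S] by blast+
  have BT: "B S \<inter> B S' = {}" if "S' \<in> T" for S'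
    using insert.prems(2)[of S S'] insert.hyps that by blast
  have sub: "B S' \<subseteq> I" "A \<inter> B S' = {}" "(A \<union> B S) \<inter> B S' = {}" if "S' \<in> T" for S'
    using insert.prems(1)[of S'] insert.prems(4)[of S'] BT[OF that] that by blast+
  have disj: "B S' \<inter> B S'' = {}" if "S' \<in> T" "S'' \<in> T" "S' \<noteq> S''" for S' S''
    using insert.prems(2)[of S' S''] that by blast
  have 1: "?E (\<lambda>X. of_bool (\<forall>i\<in>A. X i) * F X) = prod r A * ?R"
    unfolding F_def by (rule insert.IH[OF sub(1) disj insert.prems(3) sub(2)])
  have 2: "?E (\<lambda>X. of_bool (\<forall>i\<in>A \<union> B S. X i) * F X) = prod r (A \<union> B S) * ?R"
    unfolding F_def by (rule insert.IH[OF sub(1) disj _ sub(3)]) (use insert.prems(3) BS in blast)+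
  have U: "prod r (A \<union> B S) = prod r A * ?p"
    by (rule prod.union_disjoint) (use BS insert.prems(3) assms(1) finite_subset in blast)+
  \<comment> \<open>A function of one bit is affine in it: g(b) = g(False) + (g(True) - g(False))
    [b].\<close>
  have "of_bool (\<forall>i\<in>A. X i) * (\<Prod>S\<in>insert S T. g S (\<forall>i\<in>B S. X i))
      = g S False * (of_bool (\<forall>i\<in>A. X i) * F X)
        + (g S True - g S False) * (of_bool (\<forall>i\<in>A \<union> B S. X i) * F X)" for X
  proof -
    have iff: "(\<forall>i\<in>A \<union> B S. X i) \<longleftrightarrow> (\<forall>i\<in>A. X i) \<and> (\<forall>i\<in>B S. X i)" by auto
    have ins: "(\<Prod>S\<in>insert S T. g S (\<forall>i\<in>B S. X i)) = g S (\<forall>i\<in>B S. X i) * F X"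
      unfolding F_def by (rule prod.insert) (use insert.hyps in auto)
    have "of_bool a * (h b * z) = h False * (of_bool a * z) + (h True - h False) * (of_bool (a \<and> b) * z)"
      for a b and h :: "bool \<Rightarrow> real" and z
      by (cases a; cases b) (simp_all add: algebra_simps)
    then show ?thesis unfolding ins iff .
  qed
  then have "?E (\<lambda>X. of_bool (\<forall>i\<in>A. X i) * (\<Prod>S\<in>insert S T. g S (\<forall>i\<in>B S. X i)))
     = g S False * (prod r A * ?R) + (g S True - g S False) * (prod r A * ?p * ?R)"
    using int by (simp add: 1 2 U)
  also have "\<dots> = prod r A * ((g S True * ?p + g S False * (1 - ?p)) * ?R)"
    by (simp add: algebra_simps)
  finally show ?case using insert.hyps by simp
qed

lemma expectation_prod_blocks:
  fixes r :: "'i \<Rightarrow> real" and g :: "'s \<Rightarrow> bool \<Rightarrow> real"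
  assumes "finite I" "\<And>i. i \<in> I \<Longrightarrow> 0 \<le> r i \<and> r i \<le> 1" "finite T"
    and "\<And>S. S \<in> T \<Longrightarrow> B S \<subseteq> I" "\<And>S S'. S \<in> T \<Longrightarrow> S' \<in> T \<Longrightarrow> S \<noteq> S' \<Longrightarrow> B S \<inter> B S' = {}"
  shows "measure_pmf.expectation (Pi_pmf I False (\<lambda>i. bernoulli_pmf (r i))) (\<lambda>X. \<Prod>S\<in>T. g S (\<forall>i\<in>B S. X i))
    = (\<Prod>S\<in>T. g S True * (\<Prod>i\<in>B S. r i) + g S False * (1 - (\<Prod>i\<in>B S. r i)))"
  using expectation_prod_blocks_aux[OF assms, where A = "{}" and g = g] by simp

section \<open>Tail bounds\<close>

lemma pmf_markov:
  fixes u :: "'a \<Rightarrow> real"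
  assumes "finite (set_pmf M)" "\<And>x. u x \<ge> 0" "c > 0"
  shows "measure_pmf.prob M {x. u x \<ge> c} \<le> measure_pmf.expectation M u / c"
  using integral_Markov_inequality_measure[where M = M and u = u and A = "{}" and c = c] assms
  by (auto simp: pmf_integrable_finite)

lemma exp_le_quadratic:
  fixes t :: real
  assumes "\<bar>t\<bar> \<le> 1"
  shows "exp t \<le> 1 + t + t\<^sup>2"
proof (cases "t \<ge> 0")
  case False
  define s where "s = - t"
  have s: "0 \<le> s" "s \<le> 1" using False \<open>\<bar>t\<bar> \<le> 1\<close> by (auto simp: s_def)
  have "1 + s \<le> exp s" by simp
  \<comment> \<open>The product is 1 + s^3.\<close>
  have "1 \<le> (1 - s + s\<^sup>2) * (1 + s)" using s by (simp add: algebra_simps power2_eq_square)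
  also have "\<dots> \<le> (1 - s + s\<^sup>2) * exp s" using s by (intro mult_left_mono) auto
  finally have "exp (- s) \<le> 1 - s + s\<^sup>2" by (simp add: exp_minus field_simps)
  then show ?thesis by (simp add: s_def)
qed (use assms in \<open>simp add: exp_bound\<close>)

text \<open>The generating function bound is that of a Poisson variable of mean \<open>m\<close>,
  assumed for both signs of \<open>t\<close>, so one argument covers both tails.\<close>

lemma chernoff:
  fixes S :: "'a \<Rightarrow> real"
  assumes fin: "finite (set_pmf M)"
    and mgf: "\<And>t. measure_pmf.expectation M (\<lambda>x. exp (t * S x)) \<le> exp (m * (exp t - 1))"
    and \<eta>: "0 \<le> \<eta>" "\<eta> \<le> 1" and m: "m \<ge> 0"
  shows "measure_pmf.prob M {x. \<bar>S x - m\<bar> \<ge> \<eta> * m} \<le> 2 * exp (- (\<eta>\<^sup>2 * m / 4))"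
proof -
  have tail: "measure_pmf.prob M {x. sg * (S x - m) \<ge> \<eta> * m} \<le> exp (- (\<eta>\<^sup>2 * m / 4))"
    if sg: "sg \<in> {1, -1}" for sg :: real
  proof -
    \<comment> \<open>With t = \<plusminus>\<eta>/2 the quadratic bound on exp costs m \<eta>^2 / 4,
      while the threshold gains m \<eta>^2 / 2.\<close>
    define t where "t = sg * (\<eta> / 2)"
    have t: "\<bar>t\<bar> \<le> 1" "t\<^sup>2 = \<eta>\<^sup>2 / 4" "sg * t = \<eta> / 2"
      using sg \<eta> by (auto simp: t_def power2_eq_square)
    define a where "a = t * m + (\<eta> / 2) * (\<eta> * m)"
    have "{x. sg * (S x - m) \<ge> \<eta> * m} \<subseteq> {x. exp (t * S x) \<ge> exp a}"
    proof
      fix x assume "x \<in> {x. sg * (S x - m) \<ge> \<eta> * m}"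
      then have "(\<eta> / 2) * (\<eta> * m) \<le> (\<eta> / 2) * (sg * (S x - m))" using \<eta> by (intro mult_left_mono) auto
      then show "x \<in> {x. exp (t * S x) \<ge> exp a}" by (simp add: a_def t_def algebra_simps)
    qed
    then have "measure_pmf.prob M {x. sg * (S x - m) \<ge> \<eta> * m} \<le> measure_pmf.prob M {x. exp (t * S x) \<ge> exp a}"
      by (intro measure_pmf.finite_measure_mono) auto
    also have "\<dots> \<le> measure_pmf.expectation M (\<lambda>x. exp (t * S x)) / exp a"
      by (rule pmf_markov[OF fin]) auto
    also have "\<dots> \<le> exp (m * (exp t - 1)) / exp a"
      by (intro divide_right_mono mgf) auto
    also have "\<dots> = exp (m * (exp t - 1) - a)" by (simp add: exp_diff)
    also have "\<dots> \<le> exp (- (\<eta>\<^sup>2 * m / 4))"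
    proof -
      have "m * (exp t - 1) \<le> m * (t + \<eta>\<^sup>2 / 4)"
        using exp_le_quadratic[OF t(1)] m t(2) by (intro mult_left_mono) auto
      then show ?thesis by (simp add: a_def algebra_simps power2_eq_square)
    qed
    finally show ?thesis .
  qed
  have "measure_pmf.prob M {x. \<bar>S x - m\<bar> \<ge> \<eta> * m}
     \<le> measure_pmf.prob M ({x. 1 * (S x - m) \<ge> \<eta> * m} \<union> {x. -1 * (S x - m) \<ge> \<eta> * m})"
    by (intro measure_pmf.finite_measure_mono) auto
  also have "\<dots> \<le> measure_pmf.prob M {x. 1 * (S x - m) \<ge> \<eta> * m} + measure_pmf.prob M {x. -1 * (S x - m) \<ge> \<eta> * m}"
    by (rule measure_Un_le) auto
  also have "\<dots> \<le> 2 * exp (- (\<eta>\<^sup>2 * m / 4))" using tail[of 1] tail[of "-1"] by simp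
  finally show ?thesis .
qed

section \<open>Random graphs on random vertex sets\<close>

text \<open>\<open>Z \<omega> {v}\<close> says that \<open>v\<close> is a vertex and \<open>Z \<omega> {u, v}\<close> that the pair is an edge, provided
  both ends are vertices. \<open>expectation_prod\<close> is the independence of all these events.\<close>
locale random_vertex_graph =
  fixes \<Omega> :: "'w pmf" and Z :: "'w \<Rightarrow> 'v set \<Rightarrow> bool" and W :: "'v set" and \<mu> \<rho> :: real
  assumes finite_W: "finite W" and finite_\<Omega>: "finite (set_pmf \<Omega>)"
    and \<mu>: "0 < \<mu>" "\<mu> \<le> 1" and \<rho>: "0 < \<rho>" "\<rho> \<le> 1"
    and expectation_prod: "\<And>T g :: 'v set \<Rightarrow> bool \<Rightarrow> real. T \<subseteq> {S. S \<subseteq> W \<and> card S \<in> {1, 2}} \<Longrightarrow>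
      measure_pmf.expectation \<Omega> (\<lambda>\<omega>. \<Prod>S\<in>T. g S (Z \<omega> S)) =
      (\<Prod>S\<in>T. g S True * (if card S = 1 then \<mu> else \<rho>) + g S False * (1 - (if card S = 1 then \<mu> else \<rho>)))"
begin

abbreviation E where "E \<equiv> measure_pmf.expectation \<Omega>"

lemma integrable [simp]: "integrable (measure_pmf \<Omega>) (f :: 'w \<Rightarrow> real)"
  by (rule pmf_integrable_finite[OF finite_\<Omega>])

section \<open>The centred adjacency matrix and its expected trace\<close>

definition verts :: "'w \<Rightarrow> 'v set" where
  "verts \<omega> = {v \<in> W. Z \<omega> {v}}"

definition adj :: "'w \<Rightarrow> 'v \<Rightarrow> 'v set" where
  "adj \<omega> v = {u \<in> verts \<omega>. u \<noteq> v \<and> Z \<omega> {u, v}}"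

text \<open>The index set stays the deterministic \<open>W\<close>; absent vertices give zero rows.
  Writing distinctness as \<open>card {u, v} = 2\<close> makes the entry a function of the set
  \<open>{u, v}\<close>, as \<open>walk_weight_edges\<close> requires.\<close>

definition centred :: "'w \<Rightarrow> 'v \<Rightarrow> 'v \<Rightarrow> real" where
  "centred \<omega> u v = (if Z \<omega> {u} \<and> Z \<omega> {v} then (if card {u, v} = 2 then of_bool (Z \<omega> {u, v}) - \<rho> else 0) else 0)"

lemma centred_sym: "centred \<omega> u v = centred \<omega> v u"
  by (simp add: centred_def insert_commute conj_commute)

lemma prod_singletons_pairs:
  fixes F :: "'v set \<Rightarrow> real"
  assumes "finite A" "finite P" "\<forall>e\<in>P. card e = 2"
  shows "(\<Prod>S\<in>(\<lambda>v. {v}) ` A \<union> P. F S) = (\<Prod>v\<in>A. F {v}) * (\<Prod>e\<in>P. F e)"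
  by (subst prod.union_disjoint) (use assms in \<open>auto simp: prod.reindex\<close>)

lemma finite_verts [simp]: "finite (verts \<omega>)" "finite (adj \<omega> v)"
  using finite_W by (auto simp: verts_def adj_def)

text \<open>The m-th central moment of a Bernoulli variable with parameter \<rho>.\<close>

definition edge_moment :: "nat \<Rightarrow> real" where
  "edge_moment m = (1 - \<rho>) ^ m * \<rho> + (- \<rho>) ^ m * (1 - \<rho>)"

lemma edge_moment_1: "edge_moment 1 = 0"
  by (simp add: edge_moment_def algebra_simps)

lemma abs_edge_moment_le:
  assumes "m \<ge> 2"
  shows "\<bar>edge_moment m\<bar> \<le> \<rho>"
proof -
  have "\<bar>edge_moment m\<bar> \<le> (1 - \<rho>) ^ m * \<rho> + \<rho> ^ m * (1 - \<rho>)"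
    unfolding edge_moment_def using \<rho>
    by (intro order_trans[OF abs_triangle_ineq]) (simp add: abs_mult power_abs)
  also have "\<dots> \<le> (1 - \<rho>) ^ 1 * \<rho> + \<rho> ^ 2 * (1 - \<rho>)"
    using \<rho> assms by (intro add_mono mult_right_mono power_decreasing) auto
  also have "\<dots> = \<rho> - \<rho>\<^sup>2 * \<rho>" by (simp add: algebra_simps power2_eq_square)
  also have "\<dots> \<le> \<rho>" using \<rho> by simp
  finally show ?thesis .
qed

text \<open>An edge traversed exactly once contributes a first central moment, which is zero.
  Otherwise the 2k steps use at most k distinct edges, hence at most k+1 vertices; each vertex
  contributes \<mu> and each edge at most \<rho>.\<close>

lemma abs_expectation_walk_le:
  assumes ys: "set ys \<subseteq> W" "length ys = Suc (2 * k)" and k: "k > 0"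
  shows "\<bar>E (\<lambda>\<omega>. walk_weight (centred \<omega>) ys)\<bar>
    \<le> (if card (set ys) \<le> Suc k then \<mu> ^ card (set ys) * \<rho> ^ (card (set ys) - 1) else 0)"
    (is "_ \<le> ?R")
proof -
  let ?es = "walk_edges ys"
  define m where "m e = count_list ?es e" for e
  define h where "h \<omega> e = (if card e = 2 then of_bool (Z \<omega> e) - \<rho> else 0)" for \<omega> e
  have R0: "?R \<ge> 0" using \<mu> \<rho> by simp
  have W2: "2 \<le> length ys" using ys k by simp
  have wt: "walk_weight (centred \<omega>) ys = (\<Prod>v\<in>set ys. of_bool (Z \<omega> {v})) * (\<Prod>e\<in>set ?es. h \<omega> e ^ m e)" for \<omega>
    unfolding m_def by (rule walk_weight_edges[OF _ W2]) (simp add: centred_def h_def)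
  have mpos: "m e > 0" if "e \<in> set ?es" for e
    using that count_list_0_iff[of ?es e] by (auto simp: m_def)
  show ?thesis
  proof (cases "\<forall>e\<in>set ?es. card e = 2")
    case False
    \<comment> \<open>A step that stays put is recorded as a singleton edge, where \<open>h\<close>
      is 0.\<close>
    then obtain e where "e \<in> set ?es" "card e \<noteq> 2" by auto
    then have "(\<Prod>e\<in>set ?es. h \<omega> e ^ m e) = 0" for \<omega>
      using mpos by (auto simp: h_def intro!: bexI[of _ e])
    then have "walk_weight (centred \<omega>) ys = 0" for \<omega> unfolding wt by (simp only: mult_zero_right)
    then show ?thesis using R0 by simp
  next
    case True
    define g where "g S b = (if card S = 1 then of_bool b else (of_bool b - \<rho>) ^ m S)" for S :: "'v set" and b
    let ?T = "(\<lambda>v. {v}) ` set ys \<union> set ?es"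
    have T: "?T \<subseteq> {S. S \<subseteq> W \<and> card S \<in> {1, 2}}"
      using ys(1) True walk_edges_subset[of _ ys] by fastforce
    have "walk_weight (centred \<omega>) ys = (\<Prod>S\<in>?T. g S (Z \<omega> S))" for \<omega>
      using True by (subst prod_singletons_pairs) (simp_all add: wt g_def h_def)
    then have "E (\<lambda>\<omega>. walk_weight (centred \<omega>) ys) = (\<Prod>S\<in>?T. g S True *
        (if card S = 1 then \<mu> else \<rho>) + g S False * (1 - (if card S = 1 then \<mu> else \<rho>)))"
      by (simp only: expectation_prod[OF T])
    also have "\<dots> = \<mu> ^ card (set ys) * (\<Prod>e\<in>set ?es. edge_moment (m e))"
      using True by (subst prod_singletons_pairs) (simp_all add: g_def edge_moment_def)
    finally have eq: "E (\<lambda>\<omega>. walk_weight (centred \<omega>) ys) = \<mu> ^ card (set ys) * (\<Prod>e\<in>set ?es. edge_moment (m e))" .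
    show ?thesis
    proof (cases "\<exists>e\<in>set ?es. m e = 1")
      case True
      then have "(\<Prod>e\<in>set ?es. edge_moment (m e)) = 0"
        using edge_moment_1 by (metis List.finite_set prod_zero_iff)
      then have "E (\<lambda>\<omega>. walk_weight (centred \<omega>) ys) = 0" unfolding eq by (simp only: mult_zero_right)
      then show ?thesis using R0 by simp
    next
      case False
      then have m2: "m e \<ge> 2" if "e \<in> set ?es" for e using mpos[OF that] that by fastforce
      have "2 * card (set ?es) = (\<Sum>e\<in>set ?es. 2)" by simp
      also have "\<dots> \<le> (\<Sum>e\<in>set ?es. m e)" by (intro sum_mono m2)
      also have "\<dots> = 2 * k" unfolding m_def by (subst sum_count_set) (auto simp: length_walk_edges ys)
      finally have "card (set ?es) \<le> k" by simp
      with card_set_le_walk_edges[of ys] have s: "card (set ys) \<le> Suc k" "card (set ys) - 1 \<le> card (set ?es)"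
        by linarith+
      have "\<bar>E (\<lambda>\<omega>. walk_weight (centred \<omega>) ys)\<bar> = \<mu> ^ card (set ys) * (\<Prod>e\<in>set ?es. \<bar>edge_moment (m e)\<bar>)"
        using \<mu> by (simp add: eq abs_mult abs_prod power_abs)
      also have "\<dots> \<le> \<mu> ^ card (set ys) * (\<Prod>e\<in>set ?es. \<rho>)"
        using \<mu> by (intro mult_left_mono prod_mono) (auto intro!: abs_edge_moment_le m2)
      \<comment> \<open>Connectedness gives at least \<open>card (set ys) - 1\<close> edges, and
        \<rho> is at most 1.\<close>
      also have "\<dots> \<le> \<mu> ^ card (set ys) * \<rho> ^ (card (set ys) - 1)"
        using \<mu> \<rho> s by (simp add: power_decreasing)
      finally show ?thesis using s by simp
    qed
  qed
qed

definition trace :: "nat \<Rightarrow> 'w \<Rightarrow> real" where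
  "trace k \<omega> = (\<Sum>u\<in>W. mpow (centred \<omega>) W (2 * k) u u)"

lemma trace_nonneg: "trace k \<omega> \<ge> 0"
  unfolding trace_def by (rule trace_even_nonneg[OF finite_W centred_sym])

lemma expectation_trace_le:
  assumes k: "k > 0" and N: "real (card W) * (\<mu> * \<rho>) \<ge> 1"
  shows "E (trace k) \<le> real (Suc k) ^ (2 * k + 2) * (real (card W) * \<mu>) * (real (card W) * (\<mu> * \<rho>)) ^ k"
proof -
  let ?A = "{ys. set ys \<subseteq> W \<and> length ys = Suc (2 * k)}"
  have fA: "finite ?A" using finite_W by (rule finite_lists_length_eq)
  have "E (trace k) = (\<Sum>ys\<in>?A. of_bool (last ys = hd ys) * E (\<lambda>\<omega>. walk_weight (centred \<omega>) ys))"
    unfolding trace_def trace_walks[OF finite_W] by simp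
  also have "\<dots> \<le> (\<Sum>ys\<in>?A. if card (set ys) \<le> Suc k then \<mu> ^ card (set ys) * \<rho> ^ (card (set ys) - 1) else 0)"
  proof (rule sum_mono)
    fix ys assume "ys \<in> ?A"
    then have *: "\<bar>E (\<lambda>\<omega>. walk_weight (centred \<omega>) ys)\<bar>
       \<le> (if card (set ys) \<le> Suc k then \<mu> ^ card (set ys) * \<rho> ^ (card (set ys) - 1) else 0)"
      by (intro abs_expectation_walk_le k) auto
    have "of_bool b * x \<le> \<bar>x\<bar>" for b and x :: real by (cases b) auto
    with * show "of_bool (last ys = hd ys) * E (\<lambda>\<omega>. walk_weight (centred \<omega>) ys)
       \<le> (if card (set ys) \<le> Suc k then \<mu> ^ card (set ys) * \<rho> ^ (card (set ys) - 1) else 0)"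
      by (rule order_trans[rotated])
  qed
  also have "\<dots> = (\<Sum>ys | set ys \<subseteq> W \<and> length ys = Suc (2 * k) \<and> card (set ys) \<le> Suc k.
      \<mu> ^ card (set ys) * \<rho> ^ (card (set ys) - 1))"
    using fA by (subst sum.inter_filter[symmetric]) (auto intro!: sum.cong)
  also have "\<dots> \<le> real (Suc k) ^ (2 * k + 2) * (real (card W) * \<mu>) * (real (card W) * (\<mu> * \<rho>)) ^ k"
    by (rule count_lists_few_values) (use finite_W \<mu> \<rho> N in auto)
  finally show ?thesis .
qed

section \<open>Generating functions of the vertex count and of the degrees\<close>

lemma mgf_verts: "E (\<lambda>\<omega>. exp (t * real (card (verts \<omega>)))) \<le> exp (real (card W) * \<mu> * (exp t - 1))"
proof -
  define g where "g S b = (if b then exp t else 1)" for S :: "'v set" and b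
  let ?T = "(\<lambda>v. {v}) ` W \<union> {}"
  have T: "?T \<subseteq> {S. S \<subseteq> W \<and> card S \<in> {1, 2}}" by auto
  have "exp (t * real (card (verts \<omega>))) = (\<Prod>S\<in>?T. g S (Z \<omega> S))" for \<omega>
    using finite_W by (subst prod_singletons_pairs)
      (simp_all add: g_def verts_def prod.If_cases Int_def exp_of_nat_mult mult.commute[of t])
  then have "E (\<lambda>\<omega>. exp (t * real (card (verts \<omega>)))) = (\<Prod>S\<in>?T. g S True *
        (if card S = 1 then \<mu> else \<rho>) + g S False * (1 - (if card S = 1 then \<mu> else \<rho>)))"
    by (simp only: expectation_prod[OF T])
  also have "\<dots> = (exp t * \<mu> + (1 - \<mu>)) ^ card W"
    using finite_W by (subst prod_singletons_pairs) (simp_all add: g_def)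
  also have "\<dots> \<le> exp (\<mu> * (exp t - 1)) ^ card W"
  proof (rule power_mono)
    show "exp t * \<mu> + (1 - \<mu>) \<le> exp (\<mu> * (exp t - 1))"
      using exp_ge_add_one_self[of "\<mu> * (exp t - 1)"] by (simp add: algebra_simps)
    show "0 \<le> exp t * \<mu> + (1 - \<mu>)" using \<mu> by (intro add_nonneg_nonneg) auto
  qed
  also have "\<dots> = exp (real (card W) * \<mu> * (exp t - 1))"
    by (simp add: exp_of_nat_mult mult.assoc)
  finally show ?thesis .
qed

text \<open>The set does not ask \<open>v\<close> itself to be a vertex, so its size is a sum of
  independent indicators of probability \<mu>\<rho>, one for each other point of
  \<open>W\<close>.\<close>

definition star :: "'w \<Rightarrow> 'v \<Rightarrow> 'v set" where
  "star \<omega> v = {u \<in> W - {v}. Z \<omega> {u} \<and> Z \<omega> {u, v}}"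

lemma adj_eq_star: "adj \<omega> v = star \<omega> v"
  by (auto simp: adj_def star_def verts_def)

text \<open>Each indicator depends on two events, so \<open>expectation_prod\<close> does not apply
  to the exponential directly. Expanding the product of the factors 1 + c [u is a neighbour] over
  subsets \<open>U\<close> gives terms to which it does apply, and the same expansion backwards
  refolds them.\<close>

lemma mgf_star:
  assumes v: "v \<in> W"
  shows "E (\<lambda>\<omega>. exp (t * real (card (star \<omega> v)))) \<le> exp (real (card W - 1) * (\<mu> * \<rho>) * (exp t - 1))"
proof -
  define c where "c = exp t - 1"
  let ?U = "W - {v}"
  have fU: "finite ?U" using finite_W by simp
  have E_sub: "E (\<lambda>\<omega>. \<Prod>u\<in>U. c * of_bool (Z \<omega> {u} \<and> Z \<omega> {u, v})) = (\<Prod>u\<in>U. c * (\<mu> * \<rho>))" if U: "U \<subseteq> ?U" for U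
  proof -
    have fin: "finite U" using U fU finite_subset by blast
    define g where "g S b = (of_bool b :: real)" for S :: "'v set" and b
    let ?T = "(\<lambda>u. {u}) ` U \<union> (\<lambda>u. {u, v}) ` U"
    have "v \<notin> U" using U by auto
    then have card2: "\<forall>e\<in>(\<lambda>u. {u, v}) ` U. card e = 2" by (auto simp: card_insert_if)
    have inj: "inj_on (\<lambda>u. {u, v}) U" using U by (auto simp: inj_on_def doubleton_eq_iff)
    have T: "?T \<subseteq> {S. S \<subseteq> W \<and> card S \<in> {1, 2}}" using U v card2 by auto
    have "(\<Prod>u\<in>U. c * of_bool (Z \<omega> {u} \<and> Z \<omega> {u, v})) = c ^ card U * (\<Prod>S\<in>?T. g S (Z \<omega> S))" for \<omega>
      using fin by (subst prod_singletons_pairs[OF _ _ card2])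
        (simp_all add: prod.reindex[OF inj] g_def prod.distrib of_bool_conj)
    then have "E (\<lambda>\<omega>. \<Prod>u\<in>U. c * of_bool (Z \<omega> {u} \<and> Z \<omega> {u, v})) = c ^ card U * (\<Prod>S\<in>?T. g S True *
        (if card S = 1 then \<mu> else \<rho>) + g S False * (1 - (if card S = 1 then \<mu> else \<rho>)))"
      by (simp only: integral_mult_right_zero expectation_prod[OF T])
    also have "\<dots> = c ^ card U * (\<mu> ^ card U * (\<Prod>e\<in>(\<lambda>u. {u, v}) ` U. \<rho>))"
    proof -
      have "(\<Prod>e\<in>(\<lambda>u. {u, v}) ` U. g e True * (if card e = 1 then \<mu> else \<rho>)
          + g e False * (1 - (if card e = 1 then \<mu> else \<rho>))) = (\<Prod>e\<in>(\<lambda>u. {u, v}) ` U. \<rho>)"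
        using card2 by (intro prod.cong) (auto simp: g_def)
      then show ?thesis using fin by (subst prod_singletons_pairs[OF _ _ card2]) (simp_all add: g_def)
    qed
    also have "\<dots> = (\<Prod>u\<in>U. c * (\<mu> * \<rho>))"
      by (simp add: card_image[OF inj] power_mult_distrib)
    finally show ?thesis .
  qed
  have star: "exp (t * real (card (star \<omega> v))) = (\<Sum>U\<in>Pow ?U. \<Prod>u\<in>U. c * of_bool (Z \<omega> {u} \<and> Z \<omega> {u, v}))" for \<omega>
  proof -
    have "exp (t * real (card (star \<omega> v))) = exp t ^ card (star \<omega> v)"
      by (simp add: mult.commute[of t] exp_of_nat_mult)
    also have "\<dots> = (\<Prod>u\<in>?U. if Z \<omega> {u} \<and> Z \<omega> {u, v} then exp t else 1)"
      using fU by (simp add: prod.If_cases star_def Int_def)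
    also have "\<dots> = (\<Prod>u\<in>?U. c * of_bool (Z \<omega> {u} \<and> Z \<omega> {u, v}) + 1)"
      by (intro prod.cong) (auto simp: c_def)
    also have "\<dots> = (\<Sum>U\<in>Pow ?U. \<Prod>u\<in>U. c * of_bool (Z \<omega> {u} \<and> Z \<omega> {u, v}))"
      by (simp only: prod_add[OF fU] prod.neutral_const mult_1_right)
    finally show ?thesis .
  qed
  have "E (\<lambda>\<omega>. exp (t * real (card (star \<omega> v)))) = (\<Sum>U\<in>Pow ?U. \<Prod>u\<in>U. c * (\<mu> * \<rho>))"
    unfolding star by (simp add: E_sub)
  also have "\<dots> = (\<Prod>u\<in>?U. c * (\<mu> * \<rho>) + 1)"
    by (simp only: prod_add[OF fU] prod.neutral_const mult_1_right)
  also have "\<dots> = (c * (\<mu> * \<rho>) + 1) ^ (card W - 1)"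
    using v by simp
  also have "\<dots> \<le> exp (c * (\<mu> * \<rho>)) ^ (card W - 1)"
  proof (rule power_mono)
    have "\<mu> * \<rho> \<le> 1" using \<mu> \<rho> by (simp add: mult_le_one)
    moreover have "0 \<le> exp t * (\<mu> * \<rho>)" using \<mu> \<rho> by simp
    ultimately show "0 \<le> c * (\<mu> * \<rho>) + 1" by (simp add: c_def algebra_simps)
  qed (simp add: add.commute)
  also have "\<dots> = exp (real (card W - 1) * (\<mu> * \<rho>) * (exp t - 1))"
    by (simp add: c_def mult_ac flip: exp_of_nat_mult)
  finally show ?thesis .
qed

text \<open>Matches \<open>link_gap\<close> for the random graph. The extra clause, no isolated
  vertices, will supply the coface hypothesis of Garland's theorem.\<close>

definition spectral_gap :: "real \<Rightarrow> 'w \<Rightarrow> bool" where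
  "spectral_gap \<kappa> \<omega> \<longleftrightarrow> (\<forall>v\<in>verts \<omega>. adj \<omega> v \<noteq> {}) \<and>
     (\<forall>f :: 'v \<Rightarrow> real. (\<Sum>v\<in>verts \<omega>. real (card (adj \<omega> v)) * f v) = 0 \<longrightarrow>
       (\<Sum>v\<in>verts \<omega>. \<Sum>u\<in>adj \<omega> v. f v * f u) \<le> \<kappa> * (\<Sum>v\<in>verts \<omega>. real (card (adj \<omega> v)) * (f v)\<^sup>2))"

text \<open>On the present vertices the centred matrix is A - \<rho> (J - I), with J the all-ones
  matrix.\<close>

lemma quadratic_form_centred:
  defines "V \<equiv> verts"
  assumes f: "\<And>v. v \<notin> V \<omega> \<Longrightarrow> f v = 0"
  shows "(\<Sum>v\<in>W. f v * mapply (centred \<omega>) W f v) =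
    (\<Sum>v\<in>V \<omega>. \<Sum>u\<in>adj \<omega> v. f v * f u) - \<rho> * ((\<Sum>v\<in>V \<omega>. f v)\<^sup>2 - (\<Sum>v\<in>V \<omega>. (f v)\<^sup>2))"
proof -
  have VW: "V \<omega> \<subseteq> W" "finite (V \<omega>)" by (auto simp: V_def verts_def finite_W)
  have row: "mapply (centred \<omega>) W f v = (\<Sum>u\<in>adj \<omega> v. f u) - \<rho> * ((\<Sum>u\<in>V \<omega>. f u) - f v)" if v: "v \<in> V \<omega>" for v
  proof -
    have "mapply (centred \<omega>) W f v = (\<Sum>u\<in>V \<omega>. centred \<omega> v u * f u)"
      unfolding mapply_def by (rule sum.mono_neutral_right) (use VW finite_W f in auto)
    also have "\<dots> = (\<Sum>u\<in>V \<omega>. (if u \<in> adj \<omega> v then f u else 0) - \<rho> * (if u \<in> V \<omega> - {v} then f u else 0))"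
    proof (rule sum.cong[OF refl])
      fix u assume "u \<in> V \<omega>"
      then show "centred \<omega> v u * f u = (if u \<in> adj \<omega> v then f u else 0) - \<rho> * (if u \<in> V \<omega> - {v} then f u else 0)"
        using v by (cases "u = v") (auto simp: centred_def V_def verts_def adj_def insert_commute algebra_simps)
    qed
    also have "\<dots> = (\<Sum>u\<in>V \<omega> \<inter> adj \<omega> v. f u) - \<rho> * (\<Sum>u\<in>V \<omega> \<inter> (V \<omega> - {v}). f u)"
      using VW(2) by (simp only: sum_subtractf sum.inter_restrict sum_distrib_left[symmetric])
    also have "V \<omega> \<inter> adj \<omega> v = adj \<omega> v" by (auto simp: V_def adj_def)
    also have "V \<omega> \<inter> (V \<omega> - {v}) = V \<omega> - {v}" by auto
    finally show ?thesis using v VW by (simp add: sum_diff1)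
  qed
  have "(\<Sum>v\<in>W. f v * mapply (centred \<omega>) W f v) = (\<Sum>v\<in>V \<omega>. f v * mapply (centred \<omega>) W f v)"
    by (rule sum.mono_neutral_right) (use VW finite_W f in auto)
  also have "\<dots> = (\<Sum>v\<in>V \<omega>. f v * (\<Sum>u\<in>adj \<omega> v. f u) - \<rho> * (f v * (\<Sum>u\<in>V \<omega>. f u) - (f v)\<^sup>2))"
    by (intro sum.cong) (auto simp: row algebra_simps power2_eq_square)
  also have "\<dots> = (\<Sum>v\<in>V \<omega>. \<Sum>u\<in>adj \<omega> v. f v * f u) - \<rho> * ((\<Sum>v\<in>V \<omega>. f v) * (\<Sum>v\<in>V \<omega>. f v) - (\<Sum>v\<in>V \<omega>. (f v)\<^sup>2))"
    by (simp only: sum_subtractf sum_distrib_left[symmetric] sum_distrib_right[symmetric])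
  finally show ?thesis by (simp add: power2_eq_square)
qed

text \<open>Two errors are controlled: the trace bounds the form of the centred matrix, and the
  rank-one part \<rho> (sum f)^2 is small because degree-weighted orthogonality is nearly plain
  orthogonality when all degrees are close to \<open>D\<close>. With \<eta> = 1/(8K) these give 3/2
  \<eta> D F, below 4 \<eta> times the degree-weighted norm.\<close>

lemma spectral_gapI:
  fixes D K :: real
  assumes D: "D > 0" and K: "K \<ge> 1" and k: "k > 0"
    and tr: "trace k \<omega> \<le> (D / (8 * K)) ^ (2 * k)"
    and deg: "\<And>v. v \<in> W \<Longrightarrow> \<bar>real (card (star \<omega> v)) - D\<bar> \<le> 1 / (8 * K) * D"
    and V: "\<rho> * real (card (verts \<omega>)) \<le> 4 * D"
  shows "spectral_gap (1 / (2 * K)) \<omega>"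
proof -
  let ?V = "verts \<omega>" and ?d = "\<lambda>v. real (card (adj \<omega> v))"
  define \<eta> where "\<eta> = 1 / (8 * K)"
  have \<eta>: "0 < \<eta>" "\<eta> \<le> 1 / 8" using K by (auto simp: \<eta>_def field_simps)
  have dd: "\<bar>?d v - D\<bar> \<le> \<eta> * D" if "v \<in> ?V" for v
    using deg[of v] that by (simp add: adj_eq_star verts_def \<eta>_def)
  have dlow: "?d v \<ge> 7 / 8 * D" if "v \<in> ?V" for v
  proof -
    have "\<eta> * D \<le> 1 / 8 * D" using \<eta> D by (intro mult_right_mono) auto
    then show ?thesis using dd[OF that] by linarith
  qed
  show ?thesis
    unfolding spectral_gap_def
  proof (intro conjI ballI allI impI)
    fix v assume "v \<in> ?V"
    then have "?d v > 0" using dlow[of v] D by linarith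
    then show "adj \<omega> v \<noteq> {}" by auto
  next
    fix f0 :: "'v \<Rightarrow> real"
    assume orth0: "(\<Sum>v\<in>?V. ?d v * f0 v) = 0"
    define f where "f v = (if v \<in> ?V then f0 v else 0)" for v
    have ff0: "f v = f0 v" if "v \<in> ?V" for v using that by (simp add: f_def)
    have orth: "(\<Sum>v\<in>?V. ?d v * f v) = 0" using orth0 by (simp add: ff0)
    define F where "F = (\<Sum>v\<in>?V. (f v)\<^sup>2)"
    have F0: "F \<ge> 0" unfolding F_def by (intro sum_nonneg) auto
    have "(\<Sum>v\<in>W. f v * mapply (centred \<omega>) W f v) \<le> D / (8 * K) * (\<Sum>v\<in>W. (f v)\<^sup>2)"
      by (rule quadratic_form_le_trace[OF finite_W centred_sym tr[unfolded trace_def] k])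
        (use D K in auto)
    also have "(\<Sum>v\<in>W. (f v)\<^sup>2) = F"
      unfolding F_def by (rule sum.mono_neutral_right) (use finite_W in \<open>auto simp: verts_def f_def\<close>)
    finally have "(\<Sum>v\<in>?V. \<Sum>u\<in>adj \<omega> v. f v * f u) - \<rho> * ((\<Sum>v\<in>?V. f v)\<^sup>2 - F) \<le> \<eta> * D * F"
      by (subst (asm) quadratic_form_centred) (auto simp: f_def F_def \<eta>_def)
    then have 1: "(\<Sum>v\<in>?V. \<Sum>u\<in>adj \<omega> v. f v * f u) \<le> \<eta> * D * F + \<rho> * (\<Sum>v\<in>?V. f v)\<^sup>2"
      using \<rho> F0 by (simp add: right_diff_distrib) (smt (verit) mult_nonneg_nonneg)
    \<comment> \<open>Subtracts the vanishing weighted sum divided by \<open>D\<close>, which leaves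
      only the relative degree deviations as coefficients.\<close>
    have "(\<Sum>v\<in>?V. f v) = (\<Sum>v\<in>?V. (1 - ?d v / D) * f v)"
      using orth D by (simp add: left_diff_distrib sum_subtractf flip: sum_divide_distrib)
    then have "(\<Sum>v\<in>?V. f v)\<^sup>2 \<le> (\<Sum>v\<in>?V. (1 - ?d v / D)\<^sup>2) * F"
      unfolding F_def by (simp only: Cauchy_Schwarz_ineq_sum)
    also have "\<dots> \<le> (\<Sum>v\<in>?V. \<eta>\<^sup>2) * F"
    proof (intro mult_right_mono sum_mono F0)
      fix v assume v: "v \<in> ?V"
      have "\<bar>1 - ?d v / D\<bar> = \<bar>?d v - D\<bar> / D" using D by (simp add: field_simps abs_if)
      also have "\<dots> \<le> \<eta>" using dd[OF v] D by (simp add: field_simps)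
      finally show "(1 - ?d v / D)\<^sup>2 \<le> \<eta>\<^sup>2" using \<eta> by (intro abs_le_square_iff[THEN iffD1]) auto
    qed
    finally have "\<rho> * (\<Sum>v\<in>?V. f v)\<^sup>2 \<le> \<rho> * (real (card ?V) * \<eta>\<^sup>2 * F)"
      using \<rho> by (intro mult_left_mono) auto
    also have "\<dots> = (\<rho> * real (card ?V)) * (\<eta>\<^sup>2 * F)" by simp
    also have "\<dots> \<le> 4 * D * (\<eta>\<^sup>2 * F)" using F0 by (intro mult_right_mono V) auto
    also have "\<dots> = (4 * \<eta>) * (\<eta> * D * F)" by (simp add: power2_eq_square)
    also have "\<dots> \<le> 1 / 2 * (\<eta> * D * F)" using \<eta> D F0 by (intro mult_right_mono) auto
    finally have 2: "(\<Sum>v\<in>?V. \<Sum>u\<in>adj \<omega> v. f v * f u) \<le> 3 / 2 * (\<eta> * D * F)"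
      using 1 by linarith
    have "7 / 8 * D * F \<le> (\<Sum>v\<in>?V. ?d v * (f v)\<^sup>2)"
      unfolding F_def sum_distrib_left by (intro sum_mono mult_right_mono dlow) auto
    then have "4 * \<eta> * (7 / 8 * D * F) \<le> 4 * \<eta> * (\<Sum>v\<in>?V. ?d v * (f v)\<^sup>2)"
      using \<eta> by (intro mult_left_mono) auto
    moreover have "0 \<le> \<eta> * D * F" using \<eta> D F0 by simp
    ultimately have "(\<Sum>v\<in>?V. \<Sum>u\<in>adj \<omega> v. f v * f u) \<le> 4 * \<eta> * (\<Sum>v\<in>?V. ?d v * (f v)\<^sup>2)"
      using 2 by linarith
    moreover have "4 * \<eta> = 1 / (2 * K)" by (simp add: \<eta>_def)
    moreover have "(\<Sum>v\<in>?V. \<Sum>u\<in>adj \<omega> v. f v * f u) = (\<Sum>v\<in>?V. \<Sum>u\<in>adj \<omega> v. f0 v * f0 u)"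
      by (intro sum.cong refl) (auto simp: f_def adj_def)
    moreover have "(\<Sum>v\<in>?V. ?d v * (f v)\<^sup>2) = (\<Sum>v\<in>?V. ?d v * (f0 v)\<^sup>2)"
      by (simp add: ff0)
    ultimately show "(\<Sum>v\<in>?V. \<Sum>u\<in>adj \<omega> v. f0 v * f0 u) \<le> 1 / (2 * K) * (\<Sum>v\<in>?V. ?d v * (f0 v)\<^sup>2)"
      by simp
  qed
qed

text \<open>Three bad events: a large trace, by Markov; some degree off by a factor 1 \<plusminus>
  1/(8K), and too many vertices, both by Chernoff. The 128 is 2 * 8^2, the 2 coming from N \<le> 2
  (N - 1); the 256 is 4 * 8^2.\<close>

theorem prob_no_spectral_gap:
  fixes K :: real
  defines "N \<equiv> card W" and "D \<equiv> real (card W - 1) * (\<mu> * \<rho>)"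
  assumes K: "K \<ge> 1" and k: "k > 0" and N: "N \<ge> 2" and D1: "D \<ge> 1"
  shows "measure_pmf.prob \<Omega> {\<omega>. \<not> spectral_gap (1 / (2 * K)) \<omega>}
    \<le> real N * real (Suc k) ^ (2 * k + 2) * (128 * K\<^sup>2 / D) ^ k + 2 * real (N + 1) * exp (- (D / (256 * K\<^sup>2)))"
proof -
  let ?P = "measure_pmf.prob \<Omega>"
  define \<eta> where "\<eta> = 1 / (8 * K)"
  have \<eta>: "0 \<le> \<eta>" "\<eta> \<le> 1" "\<eta>\<^sup>2 = 1 / (64 * K\<^sup>2)"
    using K by (auto simp: \<eta>_def power_divide power_mult_distrib)
  have NN: "real N \<le> 2 * real (N - 1)" "real N * (\<mu> * \<rho>) \<ge> D"
    using N \<mu> \<rho> by (auto simp: D_def N_def intro!: mult_right_mono)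
  have N2D: "real N * (\<mu> * \<rho>) \<le> 2 * D"
    using mult_right_mono[OF NN(1), of "\<mu> * \<rho>"] \<mu> \<rho> by (simp add: D_def N_def mult.assoc)
  have m0: "real N * \<mu> \<ge> D"
    using NN(2) \<mu> \<rho> mult_left_le[of \<rho> "real N * \<mu>"] by (simp add: mult.assoc)
  define B1 where "B1 = {\<omega>. trace k \<omega> \<ge> (D / (8 * K)) ^ (2 * k)}"
  define B2 where "B2 v = {\<omega>. \<bar>real (card (star \<omega> v)) - D\<bar> \<ge> \<eta> * D}" for v
  \<comment> \<open>Relative deviation 1: outside this event there are at most twice the expected
    number of vertices, which yields the 4 D wanted by \<open>spectral_gapI\<close>.\<close>
  define B3 where "B3 = {\<omega>. \<bar>real (card (verts \<omega>)) - real N * \<mu>\<bar> \<ge> 1 * (real N * \<mu>)}"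
  have "{\<omega>. \<not> spectral_gap (1 / (2 * K)) \<omega>} \<subseteq> B1 \<union> (\<Union>v\<in>W. B2 v) \<union> B3"
  proof (rule subsetI, rule ccontr)
    fix \<omega> assume 1: "\<omega> \<in> {\<omega>. \<not> spectral_gap (1 / (2 * K)) \<omega>}" and 2: "\<omega> \<notin> B1 \<union> (\<Union>v\<in>W. B2 v) \<union> B3"
    have "real (card (verts \<omega>)) \<le> 2 * (real N * \<mu>)" using 2 by (auto simp: B3_def)
    then have "\<rho> * real (card (verts \<omega>)) \<le> \<rho> * (2 * (real N * \<mu>))" using \<rho> by (intro mult_left_mono) auto
    also have "\<dots> \<le> 4 * D" using N2D by (simp add: mult_ac)
    finally have "spectral_gap (1 / (2 * K)) \<omega>"
      using 2 D1 K k by (intro spectral_gapI[where D = D and k = k])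
        (auto simp: B1_def B2_def \<eta>_def not_le less_imp_le)
    with 1 show False by simp
  qed
  then have "?P {\<omega>. \<not> spectral_gap (1 / (2 * K)) \<omega>} \<le> ?P (B1 \<union> (\<Union>v\<in>W. B2 v) \<union> B3)"
    by (intro measure_pmf.finite_measure_mono) auto
  also have "\<dots> \<le> ?P B1 + (\<Sum>v\<in>W. ?P (B2 v)) + ?P B3"
    using finite_W by (intro order_trans[OF measure_Un_le] add_mono measure_UNION_le) auto
  also have "?P B1 \<le> real N * real (Suc k) ^ (2 * k + 2) * (128 * K\<^sup>2 / D) ^ k"
  proof -
    let ?x = "(D / (8 * K)) ^ (2 * k)"
    have x: "?x > 0" using D1 K by simp
    have "?P B1 \<le> E (trace k) / ?x"
      unfolding B1_def by (rule pmf_markov[OF finite_\<Omega> trace_nonneg x])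
    also have "E (trace k) \<le> real (Suc k) ^ (2 * k + 2) * (real N * \<mu>) * (real N * (\<mu> * \<rho>)) ^ k"
      unfolding N_def by (rule expectation_trace_le[OF k]) (use NN D1 in \<open>simp add: N_def\<close>)
    also have "\<dots> \<le> real (Suc k) ^ (2 * k + 2) * real N * (2 * D) ^ k"
    proof (rule mult_mono)
      show "real (Suc k) ^ (2 * k + 2) * (real N * \<mu>) \<le> real (Suc k) ^ (2 * k + 2) * real N"
        using \<mu> by (intro mult_left_mono) (auto simp: mult_left_le)
      show "(real N * (\<mu> * \<rho>)) ^ k \<le> (2 * D) ^ k"
        using \<mu> \<rho> N2D by (intro power_mono) auto
    qed (use \<mu> \<rho> in auto)
    also have "\<dots> / ?x = real N * real (Suc k) ^ (2 * k + 2) * ((2 * D) ^ k / ((D / (8 * K))\<^sup>2) ^ k)"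
      by (simp add: power_mult)
    also have "(2 * D) ^ k / ((D / (8 * K))\<^sup>2) ^ k = (128 * K\<^sup>2 / D) ^ k"
      unfolding power_divide[symmetric]
      by (rule arg_cong[where f = "\<lambda>x. x ^ k"]) (use D1 K in \<open>simp add: field_simps power2_eq_square\<close>)
    finally show ?thesis using x by (simp add: divide_right_mono)
  qed
  also have "(\<Sum>v\<in>W. ?P (B2 v)) \<le> (\<Sum>v\<in>W. 2 * exp (- (D / (256 * K\<^sup>2))))"
  proof (rule sum_mono)
    fix v assume "v \<in> W"
    then have "?P (B2 v) \<le> 2 * exp (- (\<eta>\<^sup>2 * D / 4))"
      unfolding B2_def by (intro chernoff[OF finite_\<Omega> _ \<eta>(1,2)]) 
        (use D1 mgf_star[of v] in \<open>auto simp only: D_def\<close>)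
    then show "?P (B2 v) \<le> 2 * exp (- (D / (256 * K\<^sup>2)))" by (simp add: \<eta>)
  qed
  also have "?P B3 \<le> 2 * exp (- (D / (256 * K\<^sup>2)))"
  proof -
    have "?P B3 \<le> 2 * exp (- (1\<^sup>2 * (real N * \<mu>) / 4))"
      unfolding B3_def by (intro chernoff[OF finite_\<Omega>]) (use mgf_verts \<mu> in \<open>auto simp: N_def\<close>)
    also have "\<dots> \<le> 2 * exp (- (D / (256 * K\<^sup>2)))"
    proof -
      have "1 \<le> K\<^sup>2" using K by simp
      then have "D / (256 * K\<^sup>2) \<le> D / 4" using D1 by (intro divide_left_mono) auto
      then show ?thesis using m0 by simp
    qed
    finally show ?thesis .
  qed
  finally show ?thesis by (simp add: N_def algebra_simps)
qed

end

section \<open>Links in the lower model\<close>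

text \<open>The block of \<open>S\<close> consists of the subsets of S \<union> \<tau> that contain
  \<open>S\<close>. When \<tau> is a face, these are the hyperedges that a link vertex or edge needs
  beyond \<tau> and its own endpoints.\<close>

definition link_event :: "nat set \<Rightarrow> (nat set \<Rightarrow> bool) \<Rightarrow> nat set \<Rightarrow> bool" where
  "link_event \<tau> X S \<longleftrightarrow> (\<forall>\<sigma>\<in>(\<union>) S ` Pow \<tau>. X \<sigma>)"

lemma finite_lm_index: "finite (lm_index n)"
  by (rule finite_subset[of _ "Pow {0..n}"]) (auto simp: lm_index_def)

text \<open>Deleting \<tau> from any member of a block recovers \<open>S\<close>.\<close>

lemma disjoint_link_blocks:
  assumes "S \<inter> \<tau> = {}" "S' \<inter> \<tau> = {}" "S \<noteq> S'"
  shows "(\<union>) S ` Pow \<tau> \<inter> (\<union>) S' ` Pow \<tau> = {}"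
proof (rule ccontr)
  assume "(\<union>) S ` Pow \<tau> \<inter> (\<union>) S' ` Pow \<tau> \<noteq> {}"
  then obtain t t' where "t \<subseteq> \<tau>" "t' \<subseteq> \<tau>" "S \<union> t = S' \<union> t'" by auto
  then have "S \<union> t - \<tau> = S' \<union> t' - \<tau>" "S \<union> t - \<tau> = S" "S' \<union> t' - \<tau> = S'" using assms by blast+
  with assms show False by simp
qed

text \<open>The set {0..n} has n + 1 elements and is not an index of the hypergraph; the size bound
  on \<tau> keeps \<tau> with two added vertices a proper subset.\<close>

locale link_model =
  fixes q :: "nat \<Rightarrow> nat \<Rightarrow> real" and n :: nat and \<tau> :: "nat set" and p :: real
  assumes q: "\<And>d. d < n \<Longrightarrow> p \<le> q n d \<and> q n d \<le> 1" and p: "0 < p" "p \<le> 1"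
    and \<tau>: "\<tau> \<subseteq> {0..n}" "card \<tau> + 2 \<le> n"
begin

text \<open>The probability that a whole block over an s-element set is present. Homogeneity makes
  it depend on s only, so \<open>factor 1\<close> and \<open>factor 2\<close> serve as \<mu> and
  \<rho>.\<close>

definition factor :: "nat \<Rightarrow> real" where
  "factor s = (\<Prod>t\<in>Pow \<tau>. q n (s + card t - 1))"

lemma finite_\<tau>: "finite \<tau>"
  using \<tau>(1) finite_subset by blast

lemma factor_bounds:
  assumes "s \<in> {1, 2}"
  shows "p ^ (2 ^ card \<tau>) \<le> factor s" "0 < factor s" "factor s \<le> 1"
proof -
  have 1: "p \<le> q n (s + card t - 1) \<and> q n (s + card t - 1) \<le> 1" if "t \<in> Pow \<tau>" for t
  proof (rule q)
    have "card t \<le> card \<tau>" using that finite_\<tau> by (simp add: card_mono)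
    then show "s + card t - 1 < n" using \<tau>(2) assms by auto
  qed
  have "p ^ (2 ^ card \<tau>) = (\<Prod>t\<in>Pow \<tau>. p)" using finite_\<tau> by (simp add: card_Pow)
  also have "\<dots> \<le> factor s" unfolding factor_def using 1 p by (intro prod_mono) auto
  finally show *: "p ^ (2 ^ card \<tau>) \<le> factor s" .
  show "0 < factor s" using * p zero_less_power[of p "2 ^ card \<tau>"] by linarith
  show "factor s \<le> 1" unfolding factor_def using 1 p by (intro prod_le_1) (auto intro: order_trans[of 0 p])
qed

lemma prod_block:
  assumes "S \<inter> \<tau> = {}" "finite S"
  shows "(\<Prod>\<sigma>\<in>(\<union>) S ` Pow \<tau>. q n (card \<sigma> - 1)) = factor (card S)"
proof -
  have inj: "inj_on ((\<union>) S) (Pow \<tau>)" using assms(1) by (intro inj_onI) blast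
  have "card (S \<union> t) = card S + card t" if "t \<in> Pow \<tau>" for t
    using that assms finite_subset[OF _ finite_\<tau>, of t] by (intro card_Un_disjoint) auto
  then show ?thesis unfolding prod.reindex[OF inj] factor_def by (intro prod.cong) auto
qed

sublocale random_vertex_graph "lower_hypergraph q n" "link_event \<tau>" "{0..n} - \<tau>" "factor 1" "factor 2"
proof
  show "finite (set_pmf (lower_hypergraph q n))"
    unfolding lower_hypergraph_def by (rule finite_set_Pi_pmf_bernoulli[OF finite_lm_index])
  fix T and g :: "nat set \<Rightarrow> bool \<Rightarrow> real"
  assume T: "T \<subseteq> {S. S \<subseteq> {0..n} - \<tau> \<and> card S \<in> {1, 2}}"
  have fT: "finite T" by (rule finite_subset[of _ "Pow {0..n}"]) (use T in auto)
  have S: "S \<inter> \<tau> = {}" "finite S" "card S \<in> {1, 2}" "S \<subseteq> {0..n}" if "S \<in> T" for S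
    using T that finite_subset[of S "{0..n}"] by auto
  have "measure_pmf.expectation (lower_hypergraph q n) (\<lambda>X. \<Prod>S\<in>T. g S (link_event \<tau> X S)) =
    (\<Prod>S\<in>T. g S True * (\<Prod>\<sigma>\<in>(\<union>) S ` Pow \<tau>. q n (card \<sigma> - 1))
      + g S False * (1 - (\<Prod>\<sigma>\<in>(\<union>) S ` Pow \<tau>. q n (card \<sigma> - 1))))"
    unfolding lower_hypergraph_def link_event_def
  proof (rule expectation_prod_blocks[OF finite_lm_index _ fT])
    fix \<sigma> assume "\<sigma> \<in> lm_index n"
    then have "\<sigma> \<noteq> {}" "\<sigma> \<subset> {0..n}" by (auto simp: lm_index_def)
    then have "card \<sigma> < Suc n" using psubset_card_mono[of "{0..n}" \<sigma>] by simp
    moreover have "n > 0" using \<tau>(2) by simp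
    ultimately have "card \<sigma> - 1 < n" by linarith
    from q[OF this] show "0 \<le> q n (card \<sigma> - 1) \<and> q n (card \<sigma> - 1) \<le> 1" using p by linarith
  next
    fix S assume S': "S \<in> T"
    show "(\<union>) S ` Pow \<tau> \<subseteq> lm_index n"
    proof (intro image_subsetI)
      fix t assume t: "t \<in> Pow \<tau>"
      have "card (S \<union> t) \<le> card S + card t" by (rule card_Un_le)
      also have "\<dots> \<le> 2 + card \<tau>" using S(3)[OF S'] t finite_\<tau> by (intro add_mono card_mono) auto
      finally have "card (S \<union> t) < card {0..n}" using \<tau>(2) by simp
      then have "S \<union> t \<noteq> {0..n}" by force
      moreover have "S \<noteq> {}" using S(3)[OF S'] by auto
      ultimately show "S \<union> t \<in> lm_index n" using S(4)[OF S'] t \<tau>(1) by (auto simp: lm_index_def)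
    qed
  next
    fix S S' assume "S \<in> T" "S' \<in> T" "S \<noteq> S'"
    then show "(\<union>) S ` Pow \<tau> \<inter> (\<union>) S' ` Pow \<tau> = {}"
      using S(1) by (intro disjoint_link_blocks) auto
  qed
  also have "\<dots> = (\<Prod>S\<in>T. g S True * (if card S = 1 then factor 1 else factor 2)
      + g S False * (1 - (if card S = 1 then factor 1 else factor 2)))"
    by (rule prod.cong[OF refl]) (use S prod_block in fastforce)
  finally show "measure_pmf.expectation (lower_hypergraph q n) (\<lambda>X. \<Prod>S\<in>T. g S (link_event \<tau> X S)) =
    (\<Prod>S\<in>T. g S True * (if card S = 1 then factor 1 else factor 2)
      + g S False * (1 - (if card S = 1 then factor 1 else factor 2)))" .
qed (simp_all add: factor_bounds)

end

text \<open>The constant is half of Garland's threshold 1 / (j + 1) for homology in degree j =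
  \<open>card \<tau>\<close>.\<close>

definition good_link :: "nat \<Rightarrow> nat set \<Rightarrow> (nat set \<Rightarrow> bool) \<Rightarrow> bool" where
  "good_link n \<tau> X \<longleftrightarrow> random_vertex_graph.spectral_gap (link_event \<tau>) ({0..n} - \<tau>) (1 / (2 * real (Suc (card \<tau>)))) X"

lemma finite_complex_lower_complex:
  assumes "\<And>\<sigma>. X \<sigma> \<Longrightarrow> \<sigma> \<in> lm_index n"
  shows "finite_complex (lower_complex X)"
proof -
  have sub: "lower_complex X \<subseteq> lm_index n" using assms by (auto simp: lower_complex_def)
  show ?thesis
  proof
    show "finite (lower_complex X)" using sub finite_lm_index finite_subset by blast
    show "finite \<sigma>" if "\<sigma> \<in> lower_complex X" for \<sigma>
      using that sub finite_subset[of \<sigma> "{0..n}"] by (auto simp: lm_index_def)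
  qed (auto simp: lower_complex_def)
qed

text \<open>Over an actual face \<tau> the block events describe the link: \<open>ext\<close>
  becomes \<open>verts\<close> and \<open>adj\<close>, so a good link is a link with spectral gap.
  In \<open>mem\<close> and \<open>mem2\<close>, a subset containing all the added vertices lies in
  a block, and any other subset lies in a smaller face already known.\<close>

lemma homology_vanishes_lower_complex:
  assumes X: "\<And>\<sigma>. X \<sigma> \<Longrightarrow> \<sigma> \<in> lm_index n"
    and model: "\<And>\<tau>. \<tau> \<subseteq> {0..n} \<Longrightarrow> card \<tau> = Suc j \<Longrightarrow> link_model q n \<tau> p"
    and good: "\<And>\<tau>. \<tau> \<subseteq> {0..n} \<Longrightarrow> card \<tau> = Suc j \<Longrightarrow> good_link n \<tau> X"
  shows "homology_vanishes (lower_complex X) (Suc j)"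
proof -
  let ?K = "lower_complex X"
  interpret finite_complex ?K by (rule finite_complex_lower_complex[OF X])
  have sub: "\<sigma> \<subseteq> {0..n}" if "\<sigma> \<in> ?K" for \<sigma>
    using that X by (auto simp: lower_complex_def lm_index_def)
  have key: "(\<forall>v\<in>ext ?K \<tau>. ext ?K (insert v \<tau>) \<noteq> {}) \<and> link_gap (1 / (2 * real (Suc (Suc j)))) \<tau>"
    if \<tau>: "\<tau> \<in> faces ?K j" for \<tau>
  proof -
    have \<tau>K: "\<tau> \<in> ?K" and card: "card \<tau> = Suc j" using \<tau> by (auto simp: faces_def)
    note \<tau>n = sub[OF \<tau>K]
    interpret link_model q n \<tau> p by (rule model[OF \<tau>n card])
    have face: "X s" if "\<sigma> \<in> ?K" "s \<subseteq> \<sigma>" "s \<noteq> {}" for s \<sigma>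
      using that by (simp add: lower_complex_def)
    have eventI: "link_event \<tau> X S" if "S \<union> \<tau> \<in> ?K" "S \<noteq> {}" for S
      unfolding link_event_def by (intro ballI face[OF that(1)]) (use that(2) in auto)
    have mem: "insert v \<tau> \<in> ?K \<longleftrightarrow> link_event \<tau> X {v}" for v
    proof
      assume "insert v \<tau> \<in> ?K"
      then show "link_event \<tau> X {v}" by (intro eventI) auto
    next
      assume *: "link_event \<tau> X {v}"
      have "X s" if s: "s \<noteq> {}" "s \<subseteq> insert v \<tau>" for s
      proof (cases "v \<in> s")
        case True
        then have "s = {v} \<union> (s - {v})" "s - {v} \<in> Pow \<tau>" using s by auto
        then show ?thesis using * unfolding link_event_def by blast
      next
        case False
        then show ?thesis using \<tau>K s by (auto simp: lower_complex_def)
      qed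
      then show "insert v \<tau> \<in> ?K" by (auto simp: lower_complex_def)
    qed
    have mem2: "insert u (insert v \<tau>) \<in> ?K \<longleftrightarrow> link_event \<tau> X {u} \<and> link_event \<tau> X {v} \<and> link_event \<tau> X {u, v}"
      (is "_ \<longleftrightarrow> ?R") for u v
    proof
      assume *: "insert u (insert v \<tau>) \<in> ?K"
      have "insert u \<tau> \<in> ?K" "insert v \<tau> \<in> ?K"
        by (rule face_subset[OF *]; blast)+
      moreover have "link_event \<tau> X {u, v}" using * by (intro eventI) auto
      ultimately show ?R by (simp add: mem)
    next
      assume R: ?R
      have "X s" if s: "s \<noteq> {}" "s \<subseteq> insert u (insert v \<tau>)" for s
      proof (cases "u \<in> s \<and> v \<in> s")
        case True
        then have "s = {u, v} \<union> (s - {u, v})" by blast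
        moreover have "s - {u, v} \<in> Pow \<tau>" using s(2) by blast
        ultimately show ?thesis using R unfolding link_event_def by blast
      next
        case False
        then have "s \<subseteq> insert u \<tau> \<or> s \<subseteq> insert v \<tau>" using s by blast
        moreover have "insert u \<tau> \<in> ?K" "insert v \<tau> \<in> ?K" using R mem by auto
        ultimately show ?thesis using face s(1) by blast
      qed
      then show "insert u (insert v \<tau>) \<in> ?K" by (simp add: lower_complex_def)
    qed
    have V: "ext ?K \<tau> = verts X"
    proof (rule set_eqI)
      fix v
      have "insert v \<tau> \<in> ?K \<Longrightarrow> v \<in> {0..n} \<and> v \<in> \<Union>?K" using sub by blast
      then show "v \<in> ext ?K \<tau> \<longleftrightarrow> v \<in> verts X"
        unfolding ext_def verts_def by (auto simp: mem)
    qed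
    have Adj: "ext ?K (insert v \<tau>) = adj X v" if v: "v \<in> verts X" for v
    proof (rule set_eqI)
      fix u
      have v': "v \<notin> \<tau>" "link_event \<tau> X {v}" using v by (auto simp: verts_def)
      have "insert u (insert v \<tau>) \<in> ?K \<Longrightarrow> u \<in> {0..n} \<and> u \<in> \<Union>?K" using sub by blast
      then show "u \<in> ext ?K (insert v \<tau>) \<longleftrightarrow> u \<in> adj X v"
        unfolding ext_def adj_def verts_def using v' by (auto simp: mem2)
    qed
    have "spectral_gap (1 / (2 * real (Suc (Suc j)))) X"
      using good[OF \<tau>n card] by (simp only: good_link_def card)
    then show ?thesis
      unfolding spectral_gap_def link_gap_def V by (simp add: Adj cong: sum.cong)
  qed
  show ?thesis
  proof (rule homology_vanishes_if_link_gap)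
    show "link_gap (1 / (2 * real (Suc (Suc j)))) \<tau>" if "\<tau> \<in> faces ?K j" for \<tau>
      using key[OF that] by blast
    show "1 / (2 * real (Suc (Suc j))) * (real j + 2) < 1" by (simp add: field_simps)
    fix \<sigma> assume \<sigma>: "\<sigma> \<in> faces ?K (Suc j)"
    then have "\<sigma> \<noteq> {}" "finite \<sigma>" and card: "card \<sigma> = Suc (Suc j)" and K: "\<sigma> \<in> ?K"
      using finite_face nonempty_face by (auto simp: faces_def)
    then obtain v where v: "v \<in> \<sigma>" by auto
    \<comment> \<open>View the face as a vertex of the link of its facet; that vertex is not
      isolated, so the face has a coface.\<close>
    have c: "card (\<sigma> - {v}) = Suc j" using card v \<open>finite \<sigma>\<close> by simp
    have "\<sigma> - {v} \<in> ?K" by (rule face_subset[OF K]) (use c in force)+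
    then have "\<sigma> - {v} \<in> faces ?K j" using c by (simp add: faces_def)
    moreover have "v \<in> ext ?K (\<sigma> - {v})" using v K by (auto simp: ext_def insert_absorb)
    ultimately have "ext ?K (insert v (\<sigma> - {v})) \<noteq> {}" using key by blast
    then show "ext ?K \<sigma> \<noteq> {}" using v by (simp add: insert_absorb)
  qed
qed

section \<open>Union bound\<close>

text \<open>The bound of \<open>prob_no_spectral_gap\<close> made explicit for D \<ge> x^\<epsilon>
  / 2, K \<le> l and \<open>k\<close> the rounded-up logarithm. Real powers replace natural ones so
  that it is an expression in \<open>x\<close> to which asymptotic expansion applies.\<close>

definition link_failure :: "real \<Rightarrow> real \<Rightarrow> real \<Rightarrow> real" where
  "link_failure \<epsilon> l x = (x + 1) * (ln x + 2)\<^sup>2 * ((ln x + 2)\<^sup>2 * (256 * l\<^sup>2 / x powr \<epsilon>)) powr ln x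
     + 2 * (x + 2) * exp (- (x powr \<epsilon> / (512 * l\<^sup>2)))"

lemma prob_not_good_link:
  fixes \<epsilon> l :: real
  assumes model: "link_model q n \<tau> p" and card: "real (card \<tau>) \<le> real n / 2" and n: "n \<ge> 3"
    and l: "real (card \<tau>) + 1 \<le> l"
    and dens: "real n powr (\<epsilon> - 1) \<le> p ^ (2 ^ card \<tau>) * p ^ (2 ^ card \<tau>)"
    and big: "real n powr \<epsilon> / 2 \<ge> 1"
    and small: "(ln (real n) + 2)\<^sup>2 * (256 * l\<^sup>2 / real n powr \<epsilon>) \<le> 1"
  shows "measure_pmf.prob (lower_hypergraph q n) {X. \<not> good_link n \<tau> X} \<le> link_failure \<epsilon> l (real n)"
proof -
  interpret link_model q n \<tau> p by (rule model)
  define N where "N = card ({0..n} - \<tau>)"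
  have N: "N = Suc n - card \<tau>" unfolding N_def using \<tau>(1) finite_\<tau> by (simp add: card_Diff_subset)
  define K where "K = real (Suc (card \<tau>))"
  have K: "K \<ge> 1" "K \<le> l" using l by (auto simp: K_def)
  have K2: "K\<^sup>2 \<le> l\<^sup>2" "K\<^sup>2 \<ge> 1" using K by (auto simp: power_mono)
  define k where "k = nat \<lceil>ln (real n)\<rceil>"
  have lnpos: "ln (real n) > 0" using n by simp
  have k: "k > 0" "ln (real n) \<le> real k" "real (Suc k) \<le> ln (real n) + 2"
    using lnpos unfolding k_def by linarith+
  define D where "D = real (N - 1) * (factor 1 * factor 2)"
  let ?Y = "real n powr \<epsilon>"
  have D: "D \<ge> ?Y / 2"
  proof -
    have "?Y / 2 = real n / 2 * real n powr (\<epsilon> - 1)"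
      using n by (simp add: powr_diff)
    also have "\<dots> \<le> real (N - 1) * (factor 1 * factor 2)"
    proof (rule mult_mono)
      show "real n / 2 \<le> real (N - 1)" using N card by linarith
      have "p ^ (2 ^ card \<tau>) * p ^ (2 ^ card \<tau>) \<le> factor 1 * factor 2"
        using factor_bounds p by (intro mult_mono) (auto simp: less_imp_le)
      then show "real n powr (\<epsilon> - 1) \<le> factor 1 * factor 2" using dens by linarith
    qed auto
    finally show ?thesis by (simp add: D_def)
  qed
  have Ypos: "?Y > 0" and Dpos: "D > 0" using big D by linarith+
  have "measure_pmf.prob (lower_hypergraph q n) {X. \<not> good_link n \<tau> X}
    \<le> real N * real (Suc k) ^ (2 * k + 2) * (128 * K\<^sup>2 / D) ^ k + 2 * real (N + 1) * exp (- (D / (256 * K\<^sup>2)))"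
    unfolding good_link_def K_def[symmetric] N_def D_def
    by (rule prob_no_spectral_gap) (use K k N \<tau>(2) D big in \<open>auto simp: D_def N_def[symmetric]\<close>)
  also have "\<dots> \<le> link_failure \<epsilon> l (real n)"
    unfolding link_failure_def
  proof (rule add_mono)
    let ?x = "(ln (real n) + 2)\<^sup>2 * (256 * l\<^sup>2 / ?Y)"
    have "128 * K\<^sup>2 / D \<le> 128 * l\<^sup>2 / (?Y / 2)"
      using D Ypos K2 Dpos by (intro frac_le) auto
    then have 1: "128 * K\<^sup>2 / D \<le> 256 * l\<^sup>2 / ?Y" by simp
    have s: "(real (Suc k))\<^sup>2 \<le> (ln (real n) + 2)\<^sup>2" using k by (intro power_mono) auto
    have "real (Suc k) ^ (2 * k + 2) = ((real (Suc k))\<^sup>2) ^ k * (real (Suc k))\<^sup>2"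
      by (simp only: power_add power_mult)
    then have "real N * real (Suc k) ^ (2 * k + 2) * (128 * K\<^sup>2 / D) ^ k
       = real N * (real (Suc k))\<^sup>2 * ((real (Suc k))\<^sup>2 * (128 * K\<^sup>2 / D)) ^ k"
      by (simp only: power_mult_distrib mult_ac)
    also have "\<dots> \<le> (real n + 1) * (ln (real n) + 2)\<^sup>2 * ?x ^ k"
      using N s 1 Dpos Ypos by (intro mult_mono power_mono) auto
    also have "?x ^ k \<le> ?x powr ln (real n)"
    proof -
      have "ln (real n) + 2 > 0" "l > 0" using lnpos K by linarith+
      then have x0: "?x > 0" using Ypos by (intro mult_pos_pos divide_pos_pos zero_less_power) auto
      have "?x ^ k = ?x powr real k" using x0 by (simp add: powr_realpow)
      \<comment> \<open>The base is at most 1 by \<open>small\<close>, so lowering the exponent from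
        \<open>k\<close> to \<open>ln n\<close> increases the power.\<close>
      also have "\<dots> \<le> ?x powr ln (real n)" using k x0 small by (intro powr_mono') auto
      finally show ?thesis .
    qed
    finally show "real N * real (Suc k) ^ (2 * k + 2) * (128 * K\<^sup>2 / D) ^ k
       \<le> (real n + 1) * (ln (real n) + 2)\<^sup>2 * ?x powr ln (real n)"
      by (simp add: mult_left_mono)
    have "?Y / (512 * l\<^sup>2) \<le> ?Y / (512 * K\<^sup>2)"
      using K2 Ypos K by (intro divide_left_mono mult_pos_pos mult_left_mono) auto
    also have "\<dots> \<le> D / (256 * K\<^sup>2)"
    proof -
      have "?Y / (512 * K\<^sup>2) = (?Y / 2) / (256 * K\<^sup>2)" by simp
      also have "\<dots> \<le> D / (256 * K\<^sup>2)" using D by (rule divide_right_mono) simp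
      finally show ?thesis .
    qed
    finally show "2 * real (N + 1) * exp (- (D / (256 * K\<^sup>2))) \<le> 2 * (real n + 2) * exp (- (?Y / (512 * l\<^sup>2)))"
      using N by (intro mult_mono) auto
  qed
  finally show ?thesis .
qed

section \<open>Number of vertex sets, density, and the limit\<close>

lemma card_small_subsets_le:
  "card {\<tau>. \<tau> \<subseteq> {0..n::nat} \<and> card \<tau> \<le> J} \<le> (n + 2) ^ J"
proof -
  let ?L = "{xs. set xs \<subseteq> {0..Suc n} \<and> length xs = J}"
  have "{\<tau>. \<tau> \<subseteq> {0..n} \<and> card \<tau> \<le> J} \<subseteq> (\<lambda>xs. set xs \<inter> {0..n}) ` ?L"
  proof
    fix \<tau> assume \<tau>: "\<tau> \<in> {\<tau>. \<tau> \<subseteq> {0..n} \<and> card \<tau> \<le> J}"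
    then have fin: "finite \<tau>" using finite_subset by blast
    \<comment> \<open>Short sets are padded with the dummy symbol \<open>Suc n\<close>, hence n + 2
      symbols.\<close>
    let ?xs = "sorted_list_of_set \<tau> @ replicate (J - card \<tau>) (Suc n)"
    have "?xs \<in> ?L" "\<tau> = set ?xs \<inter> {0..n}" using \<tau> fin by auto
    then show "\<tau> \<in> (\<lambda>xs. set xs \<inter> {0..n}) ` ?L" by blast
  qed
  then have "card {\<tau>. \<tau> \<subseteq> {0..n} \<and> card \<tau> \<le> J} \<le> card ?L"
    by (rule surj_card_le[rotated]) (rule finite_lists_length_eq, simp)
  also have "\<dots> = (n + 2) ^ J" by (subst card_lists_length_eq) auto
  finally show ?thesis .
qed

text \<open>The union bound costs exp(O(ln n log log n)). The trace term is exp(-(\<epsilon> + o(1))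
  (ln n)^2), and the degree term is exponentially small in a power of \<open>n\<close> up to
  logarithms.\<close>

lemma tendsto_total_failure:
  fixes \<epsilon> a :: real
  assumes "\<epsilon> > 0" "a > 0"
  shows "(\<lambda>n. (real n + 2) powr log 2 (ln (real n) / a) *
     link_failure \<epsilon> (log 2 (ln (real n) / a)) (real n)) \<longlonglongrightarrow> 0"
proof -
  have "(\<lambda>n. (real n + 2) powr log 2 (ln (real n) / a) * ((real n + 1) * (ln (real n) + 2)\<^sup>2 *
      ((ln (real n) + 2)\<^sup>2 * (256 * (log 2 (ln (real n) / a))\<^sup>2 / real n powr \<epsilon>)) powr ln (real n))) \<longlonglongrightarrow> 0"
    unfolding log_def using assms by real_asymp
  moreover have "(\<lambda>n. (real n + 2) powr log 2 (ln (real n) / a) *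
      (2 * (real n + 2) * exp (- (real n powr \<epsilon> / (512 * (log 2 (ln (real n) / a))\<^sup>2))))) \<longlonglongrightarrow> 0"
    unfolding log_def using assms by real_asymp
  ultimately show ?thesis
    unfolding link_failure_def distrib_left by (rule tendsto_add_zero)
qed

text \<open>With L the logarithm of \<open>n\<close> to base 1/p, the range of \<open>j\<close> says
  2^(j+1) \<le> L 2^(-\<delta>). Raising p to these exponents and using p^L = 1/n gives the
  claim.\<close>

lemma density_bound:
  fixes p c :: real
  assumes p: "0 < p" "p < 1" and n: "real n > 1" and L: "log (1 / p) (real n) > 0"
    and j: "real j \<le> log 2 (log (1 / p) (real n)) - 1 - \<delta>"
  shows "real n powr (- (2 powr - \<delta>)) \<le> p ^ (2 ^ j) * p ^ (2 ^ j)"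
proof -
  let ?L = "log (1 / p) (real n)"
  have "2 powr (real j + 1) \<le> 2 powr (log 2 ?L - \<delta>)" using j by (intro powr_mono) auto
  also have "\<dots> = ?L * 2 powr - \<delta>" using L by (simp add: powr_diff powr_minus divide_inverse)
  finally have 1: "real (2 ^ Suc j) \<le> ?L * 2 powr - \<delta>"
    by (simp add: powr_add powr_realpow)
  have "real n = (1 / p) powr ?L" using p n by (subst powr_log_cancel) auto
  then have "real n powr (- (2 powr - \<delta>)) = ((1 / p) powr ?L) powr (- (2 powr - \<delta>))" by simp
  also have "\<dots> = (1 / p) powr - (?L * 2 powr - \<delta>)" by (simp add: powr_powr)
  also have "\<dots> = p powr (?L * 2 powr - \<delta>)" using p by (simp add: powr_minus powr_divide)
  also have "\<dots> \<le> p powr real (2 ^ Suc j)" using 1 p by (intro powr_mono') auto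
  also have "\<dots> = p ^ (2 ^ j) * p ^ (2 ^ j)"
    by (subst powr_realpow[OF p(1)]) (simp add: power_add mult_2)
  finally show ?thesis .
qed

theorem theorem7p1:
  fixes q :: "nat \<Rightarrow> nat \<Rightarrow> real" and p P \<delta>0 :: real
  assumes "0 < p" and "p \<le> P" and "P < 1"
    and "\<And>n d. d < n \<Longrightarrow> p \<le> q n d \<and> q n d \<le> P"
    and "\<delta>0 > 0"
  shows "(\<lambda>n. measure_pmf.prob (lower_hypergraph q n)
           {X. \<forall>j::nat. 0 < j \<and> real j \<le> log 2 (log (1 / p) (real n)) - 1 - \<delta>0
                 \<longrightarrow> homology_vanishes (lower_complex X) j}) \<longlonglongrightarrow> 1"
proof -
  define a where "a = ln (1 / p)"
  define \<epsilon> where "\<epsilon> = 1 - 2 powr - \<delta>0"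
  define l where "l n = log 2 (ln (real n) / a)" for n
  have l: "log 2 (log (1 / p) (real n)) = l n" for n by (simp add: l_def a_def log_def)
  have p1: "p < 1" using assms by simp
  have a: "a > 0" using assms(1) p1 by (simp add: a_def)
  have \<epsilon>: "\<epsilon> > 0" using powr_less_mono[of "-\<delta>0" 0 2] assms(5) by (simp add: \<epsilon>_def)
  define G where "G n = {X. \<forall>j::nat. 0 < j \<and> real j \<le> l n - 1 - \<delta>0
                 \<longrightarrow> homology_vanishes (lower_complex X) j}" for n
  define fail where "fail n = (real n + 2) powr l n * link_failure \<epsilon> (l n) (real n)" for n
  have bound: "1 - fail n \<le> measure_pmf.prob (lower_hypergraph q n) (G n)"
    if n: "n \<ge> 3" and l1: "l n \<ge> 1" and l2: "l n \<le> real n / 2 - 2"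
      and big: "real n powr \<epsilon> / 2 \<ge> 1"
      and small: "(ln (real n) + 2)\<^sup>2 * (256 * (l n)\<^sup>2 / real n powr \<epsilon>) \<le> 1" for n
  proof -
    let ?H = "lower_hypergraph q n"
    \<comment> \<open>Homology in degree i uses the links of sets with i elements, so the bound on
      degrees becomes a bound on cardinalities. The family is deterministic, as a union bound
      requires.\<close>
    define T where "T = {\<tau>. \<tau> \<subseteq> {0..n} \<and> real (card \<tau>) \<le> l n - 1 - \<delta>0}"
    have fT: "finite T" by (rule finite_subset[of _ "Pow {0..n}"]) (auto simp: T_def)
    have model: "link_model q n \<tau> p" if "\<tau> \<in> T" for \<tau>
    proof
      show "p \<le> q n d \<and> q n d \<le> 1" if "d < n" for d using assms(3) assms(4)[OF that] by linarith
      have "real (card \<tau>) + 2 \<le> real n" using that l2 assms(5) n by (simp add: T_def)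
      then show "card \<tau> + 2 \<le> n" by linarith
    qed (use that assms(1) p1 in \<open>simp_all add: T_def\<close>)
    have prob: "measure_pmf.prob ?H {X. \<not> good_link n \<tau> X} \<le> link_failure \<epsilon> (l n) (real n)" if \<tau>: "\<tau> \<in> T" for \<tau>
    proof (rule prob_not_good_link[OF model[OF \<tau>]])
      have "real n powr (- (2 powr - \<delta>0)) \<le> p ^ (2 ^ card \<tau>) * p ^ (2 ^ card \<tau>)"
      proof (rule density_bound)
        show "log (1 / p) (real n) > 0" using a n by (simp add: log_def a_def)
        show "real (card \<tau>) \<le> log 2 (log (1 / p) (real n)) - 1 - \<delta>0" using \<tau> by (simp add: l T_def)
      qed (use assms(1) p1 n in simp_all)
      then show "real n powr (\<epsilon> - 1) \<le> p ^ (2 ^ card \<tau>) * p ^ (2 ^ card \<tau>)" by (simp add: \<epsilon>_def)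
      have *: "real (card \<tau>) \<le> l n - 1 - \<delta>0" using \<tau> by (simp add: T_def)
      show "real (card \<tau>) \<le> real n / 2" "real (card \<tau>) + 1 \<le> l n"
        using * l2 assms(5) by linarith+
    qed (fact n big small)+
    have "measure_pmf.prob ?H (- G n) \<le> measure_pmf.prob ?H (\<Union>\<tau>\<in>T. {X. \<not> good_link n \<tau> X})"
    \<comment> \<open>A sample vanishes outside \<open>lm_index n\<close> only on the support;
      intersecting with it provides the hypothesis that makes \<open>lower_complex X\<close>
      finite.\<close>
    proof (subst measure_Int_set_pmf[symmetric], rule measure_pmf.finite_measure_mono)
      show "- G n \<inter> set_pmf ?H \<subseteq> (\<Union>\<tau>\<in>T. {X. \<not> good_link n \<tau> X})"
      proof (rule subsetI, rule ccontr)
        fix X assume X: "X \<in> - G n \<inter> set_pmf ?H" and "X \<notin> (\<Union>\<tau>\<in>T. {X. \<not> good_link n \<tau> X})"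
        then have good: "good_link n \<tau> X" if "\<tau> \<in> T" for \<tau> using that by blast
        from X obtain i where i: "0 < i" "real i \<le> l n - 1 - \<delta>0" "\<not> homology_vanishes (lower_complex X) i"
          by (auto simp: G_def)
        then obtain j where j: "i = Suc j" using gr0_implies_Suc by blast
        have "homology_vanishes (lower_complex X) (Suc j)"
        proof (rule homology_vanishes_lower_complex)
          show "\<sigma> \<in> lm_index n" if "X \<sigma>" for \<sigma>
            using X that set_Pi_pmf_subset[OF finite_lm_index, of n False] unfolding lower_hypergraph_def by blast
          show "link_model q n \<tau> p" "good_link n \<tau> X" if "\<tau> \<subseteq> {0..n}" "card \<tau> = Suc j" for \<tau>
            using that i j by (auto intro!: model good simp: T_def)
        qed
        with i j show False by simp
      qed
    qed simp
    also have "\<dots> \<le> (\<Sum>\<tau>\<in>T. measure_pmf.prob ?H {X. \<not> good_link n \<tau> X})"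
      by (rule measure_UNION_le[OF fT]) simp
    also have "\<dots> \<le> real (card T) * link_failure \<epsilon> (l n) (real n)"
      using sum_mono[of T, OF prob] by simp
    also have "\<dots> \<le> fail n"
      unfolding fail_def
    proof (rule mult_right_mono)
      define J where "J = nat \<lfloor>l n\<rfloor>"
      have J: "real J \<le> l n" using l1 by (simp add: J_def)
      have "T \<subseteq> {\<tau>. \<tau> \<subseteq> {0..n} \<and> card \<tau> \<le> J}"
        using assms(5) unfolding T_def J_def by (auto simp: le_nat_floor)
      then have "card T \<le> card {\<tau>. \<tau> \<subseteq> {0..n} \<and> card \<tau> \<le> J}"
        by (rule card_mono[rotated]) (rule finite_subset[of _ "Pow {0..n}"], auto)
      also have "\<dots> \<le> (n + 2) ^ J" by (rule card_small_subsets_le)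
      finally have "real (card T) \<le> real ((n + 2) ^ J)" by (simp only: of_nat_le_iff)
      also have "\<dots> = (real n + 2) powr real J" by (simp add: powr_realpow add.commute)
      also have "\<dots> \<le> (real n + 2) powr l n" using J by (intro powr_mono) auto
      finally show "real (card T) \<le> (real n + 2) powr l n" .
      have "0 \<le> ln (real n)" using n by simp
      then show "0 \<le> link_failure \<epsilon> (l n) (real n)" by (simp add: link_failure_def)
    qed
    finally have "measure_pmf.prob ?H (- G n) \<le> fail n" .
    then show ?thesis using measure_pmf.prob_compl[of "G n" ?H] by (simp add: Compl_eq_Diff_UNIV)
  qed
  have "fail \<longlonglongrightarrow> 0"
    using tendsto_total_failure[OF \<epsilon> a] by (simp add: fail_def[abs_def] l_def)
  then have lim: "(\<lambda>n. 1 - fail n) \<longlonglongrightarrow> 1" using tendsto_diff[OF tendsto_const] by fastforce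
  have ev: "eventually (\<lambda>n. l n \<ge> 1) sequentially" "eventually (\<lambda>n. l n \<le> real n / 2 - 2) sequentially"
    "eventually (\<lambda>n. real n powr \<epsilon> / 2 \<ge> 1) sequentially"
    "eventually (\<lambda>n. (ln (real n) + 2)\<^sup>2 * (256 * (l n)\<^sup>2 / real n powr \<epsilon>) \<le> 1) sequentially"
    unfolding l_def log_def using a \<epsilon> by real_asymp+
  have "eventually (\<lambda>n. 1 - fail n \<le> measure_pmf.prob (lower_hypergraph q n) (G n)) sequentially"
    using eventually_ge_at_top[of 3] ev by eventually_elim (rule bound)
  then have "(\<lambda>n. measure_pmf.prob (lower_hypergraph q n) (G n)) \<longlonglongrightarrow> 1"
    by (rule tendsto_sandwich[OF _ _ lim tendsto_const]) auto
  then show ?thesis by (simp only: G_def l)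
qed

end
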